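(* Let $G=\bigoplus_{i\in I}G_i$ be a Warfield group, where each $G_i\in\mathcal B$, and suppose the torsion subgroup $T$ of $G$ is strongly Hopfian. Then the following are equivalent: (1) $G$ is uniformly strongly Hopfian; (2) $G$ is strongly Hopfian; (3) there is an $n\in\mathbb N$ such that there is no subset $\{i_1,i_2,\dots,i_n\}$ of $I$ with exactly $n$ (distinct) elements such that $G_{i_1}\precsim G_{i_2}\precsim\cdots\precsim G_{i_{n-1}}\precsim G_{i_n}$.
   Context: All groups are abelian and written additively. $\mathbb N$ denotes the positive integers. A group $G$ is strongly Hopfian (SH) if for every endomorphism $\phi$ of $G$ there is $n\in\mathbb N$ such that $\phi$ restricted to $\phi^n(G)$ is injective (equivalently, $\ker\phi^n=\ker\phi^m$ for all $m\ge n$); such an $n$ is called an SH-exponent for $\phi$. $G$ is uniformly SH if a single $n\in\mathbb N$ is an SH-exponent for all endomorphisms of $G$. A (global) Warfield group is a group isomorphic to a direct summand of a simply presented group, i.e. of a group definable by generators and relations all of the form $mx=0$ or $mx=y$ with $x,y$ generators and $m$ an integer. $\mathcal B$ denotes the class of all groups of torsion-free rank 1 with bounded $p$-torsion, meaning that for every prime $p$ the $p$-torsion subgroup is bounded (annihilated by some power of $p$). For $A,A'\in\mathcal B$, write $A\precsim A'$ if there is a homomorphism $\phi:A\to A'$ such that $\phi(A)$ is not contained in the torsion subgroup of $A'$. *)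

theory Defs
  imports "HOL-Algebra.Free_Abelian_Groups" "HOL-Computational_Algebra.Primes"
begin

text \<open>
  Abelian groups are commutative groups in the sense of HOL-Algebra, hence written
  multiplicatively: the multiple \<open>n x\<close> appears as \<open>x [^] n\<close>, and direct sums are
  instances of \<^const>\<open>sum_group\<close>.
\<close>

subsection \<open>Torsion\<close>

definition torsion_set :: "('a, 'm) monoid_scheme \<Rightarrow> 'a set" where
  "torsion_set G = {x \<in> carrier G. \<exists>n::nat. n > 0 \<and> x [^]\<^bsub>G\<^esub> n = \<one>\<^bsub>G\<^esub>}"

abbreviation torsion_subgroup :: "('a, 'm) monoid_scheme \<Rightarrow> ('a, 'm) monoid_scheme" where
  "torsion_subgroup G \<equiv> G\<lparr>carrier := torsion_set G\<rparr>"

definition p_torsion_set :: "nat \<Rightarrow> ('a, 'm) monoid_scheme \<Rightarrow> 'a set" where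
  "p_torsion_set p G = {x \<in> carrier G. \<exists>k::nat. x [^]\<^bsub>G\<^esub> (p ^ k) = \<one>\<^bsub>G\<^esub>}"

definition bounded_p_torsion :: "('a, 'm) monoid_scheme \<Rightarrow> bool" where
  "bounded_p_torsion G \<longleftrightarrow>
     (\<forall>p::nat. prime p \<longrightarrow> (\<exists>k::nat. \<forall>x\<in>p_torsion_set p G. x [^]\<^bsub>G\<^esub> (p ^ k) = \<one>\<^bsub>G\<^esub>))"

subsection \<open>Torsion-free rank\<close>

text \<open>
  Linear independence over the integers. All coefficients are required to vanish, so
  the members of an independent set have infinite order.
\<close>

definition int_independent :: "('a, 'm) monoid_scheme \<Rightarrow> 'a set \<Rightarrow> bool" where
  "int_independent G B \<longleftrightarrow> B \<subseteq> carrier G \<and>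
     (\<forall>F (c :: 'a \<Rightarrow> int). finite F \<and> F \<subseteq> B \<and> (\<Otimes>\<^bsub>G\<^esub>x\<in>F. x [^]\<^bsub>G\<^esub> c x) = \<one>\<^bsub>G\<^esub>
        \<longrightarrow> (\<forall>x\<in>F. c x = 0))"

definition has_torsion_free_rank :: "('a, 'm) monoid_scheme \<Rightarrow> nat \<Rightarrow> bool" where
  "has_torsion_free_rank G r \<longleftrightarrow>
     (\<exists>B. int_independent G B \<and> (\<forall>C. int_independent G C \<and> B \<subseteq> C \<longrightarrow> C = B) \<and>
          finite B \<and> card B = r)"

definition class_B :: "('a, 'm) monoid_scheme \<Rightarrow> bool" where
  "class_B G \<longleftrightarrow> comm_group G \<and> has_torsion_free_rank G 1 \<and> bounded_p_torsion G"

definition precsim :: "('a, 'm) monoid_scheme \<Rightarrow> ('b, 'n) monoid_scheme \<Rightarrow> bool"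
    (infix \<open>\<precsim>\<close> 50) where
  "A \<precsim> A' \<longleftrightarrow> (\<exists>\<phi>\<in>hom A A'. \<not> \<phi> ` carrier A \<subseteq> torsion_set A')"

subsection \<open>Strongly Hopfian groups\<close>

definition SH_exponent :: "('a, 'm) monoid_scheme \<Rightarrow> ('a \<Rightarrow> 'a) \<Rightarrow> nat \<Rightarrow> bool" where
  "SH_exponent G \<phi> n \<longleftrightarrow> n > 0 \<and> inj_on \<phi> ((\<phi> ^^ n) ` carrier G)"

definition strongly_Hopfian :: "('a, 'm) monoid_scheme \<Rightarrow> bool" where
  "strongly_Hopfian G \<longleftrightarrow> (\<forall>\<phi>\<in>hom G G. \<exists>n. SH_exponent G \<phi> n)"

definition uniformly_strongly_Hopfian :: "('a, 'm) monoid_scheme \<Rightarrow> bool" where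
  "uniformly_strongly_Hopfian G \<longleftrightarrow> (\<exists>n. \<forall>\<phi>\<in>hom G G. SH_exponent G \<phi> n)"

subsection \<open>Simply presented groups and Warfield groups\<close>

text \<open>
  The abelian group with generators \<open>V\<close> and relators \<open>R\<close>.
\<close>

definition presented_group ::
    "'x set \<Rightarrow> ('x \<Rightarrow>\<^sub>0 int) set \<Rightarrow> ('x \<Rightarrow>\<^sub>0 int) set monoid" where
  "presented_group V R = free_Abelian_group V Mod generate (free_Abelian_group V) R"

text \<open>
  Relators of the relations \<open>m x = 0\<close> and \<open>m x = y\<close>.
\<close>

definition simple_relators :: "'x set \<Rightarrow> ('x \<Rightarrow>\<^sub>0 int) set" where
  "simple_relators V =
     {frag_cmul m (frag_of x) | m x. x \<in> V} \<union>
     {frag_cmul m (frag_of x) - frag_of y | m x y. x \<in> V \<and> y \<in> V}"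

text \<open>
  The first argument below fixes the type from which generators are drawn, since a
  definition cannot quantify over types. In a theorem that type is a free type
  variable, so a Warfield hypothesis there covers generating sets of any size.
  Nothing is lost by taking \<open>S\<close> of the specific type in \<open>warfield_group\<close>: every group
  presented on generators of type \<open>'x\<close> has an isomorphic copy in that type.
\<close>

definition simply_presented :: "'x itself \<Rightarrow> ('a, 'm) monoid_scheme \<Rightarrow> bool" where
  "simply_presented TYPE('x) S \<longleftrightarrow> comm_group S \<and>
     (\<exists>(V :: 'x set) R. R \<subseteq> simple_relators V \<and> S \<cong> presented_group V R)"

definition direct_summand :: "'a set \<Rightarrow> ('a, 'm) monoid_scheme \<Rightarrow> bool" where
  "direct_summand H S \<longleftrightarrow> subgroup H S \<and>
     (\<exists>K. subgroup K S \<and> H \<inter> K = {\<one>\<^bsub>S\<^esub>} \<and> H <#>\<^bsub>S\<^esub> K = carrier S)"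

definition warfield_group :: "'x itself \<Rightarrow> ('a, 'm) monoid_scheme \<Rightarrow> bool" where
  "warfield_group TYPE('x) G \<longleftrightarrow> comm_group G \<and>
     (\<exists>(S :: ('x \<Rightarrow>\<^sub>0 int) set monoid) H.
        simply_presented TYPE('x) S \<and> direct_summand H S \<and> G \<cong> S\<lparr>carrier := H\<rparr>)"

end

theory Submission
  imports Defs
begin

text \<open>
  Write \<open>T\<close> for the torsion subgroup of \<open>G\<close>. Uniform strong Hopficity trivially implies strong
  Hopficity; the other two implications rest on the fact that \<open>\<precsim>\<close> is a preorder on groups of
  torsion-free rank one, because a homomorphism between such groups that is nonzero modulo torsion
  is injective modulo torsion (\<open>rank_one_hom\<close>).

  Suppose there are chains of every finite length. By transitivity, finitely many indices can be
  deleted from a chain, so pairwise disjoint chains of all lengths exist. Shifting each of them one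
  step upwards defines a single endomorphism of the direct sum, and an element of infinite order at
  the bottom of a chain of \<open>n + 1\<close> groups is killed by the power \<open>n + 1\<close> of this endomorphism but
  not by the power \<open>n\<close>. So \<open>G\<close> is not strongly Hopfian (\<open>not_SH_if_unbounded_chains\<close>).

  Conversely let no chain of \<open>n\<close> indices exist. If \<open>N\<close> bounds the exponents modulo torsion and
  \<open>e\<close> is a common exponent on \<open>T\<close>, then \<open>N + e\<close> is an exponent for every endomorphism of \<open>G\<close>
  (\<open>SH_exponent_extension\<close>), so it is enough to bound these two separately.

  Modulo torsion: for a set \<open>J\<close> of indices closed downwards under \<open>\<precsim>\<close>, the elements whose
  components at \<open>J\<close> are torsion form a fully invariant subgroup. The sets of indices that start a
  strictly ascending chain of length \<open>k + 1\<close> are downward closed, decrease with \<open>k\<close>, and are empty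
  for \<open>k = n - 1\<close>; they give a filtration of \<open>G\<close> that ends in \<open>T\<close> after \<open>n - 1\<close> steps. Each
  filtration step decomposes along classes of mutually comparable indices. Such a class has fewer
  than \<open>n\<close> members, and on a torsion-free quotient of rank less than \<open>n\<close> an endomorphism that is
  nilpotent at an element kills it in fewer than \<open>n\<close> steps (\<open>nilpotent_within_rank\<close>). Altogether
  \<open>n * (n - 1)\<close> steps suffice (\<open>nilpotent_modulo_torsion\<close>).

  On \<open>T\<close>: a strongly Hopfian torsion group is uniformly strongly Hopfian
  (\<open>uniformly_SH_if_SH_torsion\<close>). Multiplication by \<open>p\<close> shows that the \<open>p\<close>-component is bounded.
  If it were infinite, it would contain an infinite direct sum of cyclic groups of equal order that
  is a direct summand of the group, and the shift on that summand would violate strong Hopficity.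
  Hence every \<open>p\<close>-component is finite and has a worst endomorphism. These endomorphisms, one for
  each prime, glue to one endomorphism of \<open>T\<close>, and any exponent for it serves all endomorphisms.
\<close>

section \<open>Torsion elements and endomorphisms\<close>

context comm_group
begin

lemma torsion_set_int:
  "torsion_set G = {x \<in> carrier G. \<exists>n::int. n \<noteq> 0 \<and> x [^] n = \<one>}"
proof -
  have "\<exists>m::nat. m > 0 \<and> x [^] m = \<one>" if "x \<in> carrier G" "n \<noteq> 0" "x [^] n = \<one>" for x and n :: int
  proof (cases "n > 0")
    case True
    then show ?thesis
      using that by (intro exI[of _ "nat n"]) simp
  next
    case False
    with that have "n < 0" "inv (x [^] nat (- n)) = \<one>"
      by (simp_all add: int_pow_def2 del: pow_nat)
    with that show ?thesis
      by (intro exI[of _ "nat (-n)"]) (auto simp del: pow_nat)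
  qed
  moreover have "\<exists>m::int. m \<noteq> 0 \<and> x [^] m = \<one>" if "n > 0" "x [^] n = \<one>" for x and n :: nat
    using that by (intro exI[of _ "int n"]) (simp add: int_pow_int)
  ultimately show ?thesis
    unfolding torsion_set_def by blast
qed

lemma torsion_set_carrier: "x \<in> torsion_set G \<Longrightarrow> x \<in> carrier G"
  by (simp add: torsion_set_def)

lemma subgroup_torsion_set: "subgroup (torsion_set G) G"
proof (rule subgroupI)
  show "torsion_set G \<noteq> {}"
    unfolding torsion_set_def using one_closed nat_pow_one[of 1] by blast
  show "inv x \<in> torsion_set G" if "x \<in> torsion_set G" for x
    using that by (auto simp: torsion_set_def nat_pow_inv)
  show "x \<otimes> y \<in> torsion_set G" if "x \<in> torsion_set G" "y \<in> torsion_set G" for x y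
  proof -
    from that(1) obtain m :: nat where m: "m > 0" "x [^] m = \<one>"
      by (auto simp: torsion_set_def)
    from that(2) obtain n :: nat where n: "n > 0" "y [^] n = \<one>"
      by (auto simp: torsion_set_def)
    have c: "x \<in> carrier G" "y \<in> carrier G"
      using that by (auto simp: torsion_set_def)
    have "(x \<otimes> y) [^] (m * n) = (x [^] m) [^] n \<otimes> (y [^] n) [^] m"
      using c by (simp add: nat_pow_distrib nat_pow_pow mult.commute)
    then have "(x \<otimes> y) [^] (m * n) = \<one>"
      using m n by simp
    moreover have "m * n > 0" using m n by simp
    ultimately show ?thesis
      using c unfolding torsion_set_def by blast
  qed
qed (auto simp: torsion_set_def)

lemma torsion_set_pow_iff:
  assumes "x \<in> carrier G" "n \<noteq> 0"
  shows "x [^] (n::int) \<in> torsion_set G \<longleftrightarrow> x \<in> torsion_set G"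
proof
  assume "x [^] n \<in> torsion_set G"
  then obtain m :: int where "m \<noteq> 0" "(x [^] n) [^] m = \<one>"
    by (auto simp: torsion_set_int)
  then have "x [^] (n * m) = \<one>" "n * m \<noteq> 0"
    using assms by (simp_all add: int_pow_pow)
  then show "x \<in> torsion_set G"
    using assms(1) unfolding torsion_set_int by blast
next
  assume "x \<in> torsion_set G"
  then show "x [^] n \<in> torsion_set G"
    using subgroup_int_pow_closed[OF subgroup_torsion_set] by simp
qed

lemma hom_funpow: "\<phi> \<in> hom G G \<Longrightarrow> \<phi> ^^ n \<in> hom G G"
  by (induction n) (auto simp: hom_def Pi_iff)

text \<open>
  The kernel form of the definition: an element killed by \<open>\<phi> ^^ Suc n\<close> is already killed by
  \<open>\<phi> ^^ n\<close>.
\<close>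

lemma SH_exponent_iff:
  assumes "\<phi> \<in> hom G G"
  shows "SH_exponent G \<phi> n \<longleftrightarrow>
    n > 0 \<and> (\<forall>x \<in> carrier G. (\<phi> ^^ Suc n) x = \<one> \<longrightarrow> (\<phi> ^^ n) x = \<one>)"
proof -
  interpret p: group_hom G G \<phi>
    using assms by (simp add: group_hom_def group_hom_axioms_def)
  interpret pn: group_hom G G "\<phi> ^^ n"
    using hom_funpow[OF assms] by (simp add: group_hom_def group_hom_axioms_def)
  have "inj_on \<phi> ((\<phi> ^^ n) ` carrier G) \<longleftrightarrow>
      (\<forall>x \<in> carrier G. \<phi> ((\<phi> ^^ n) x) = \<one> \<longrightarrow> (\<phi> ^^ n) x = \<one>)"
  proof
    assume inj: "inj_on \<phi> ((\<phi> ^^ n) ` carrier G)"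
    show "\<forall>x \<in> carrier G. \<phi> ((\<phi> ^^ n) x) = \<one> \<longrightarrow> (\<phi> ^^ n) x = \<one>"
    proof (intro ballI impI)
      fix x assume "x \<in> carrier G" "\<phi> ((\<phi> ^^ n) x) = \<one>"
      then show "(\<phi> ^^ n) x = \<one>"
        using inj_onD[OF inj, of "(\<phi> ^^ n) x" "(\<phi> ^^ n) \<one>"]
        by (simp add: imageI del: pn.hom_one) simp
    qed
  next
    assume *: "\<forall>x \<in> carrier G. \<phi> ((\<phi> ^^ n) x) = \<one> \<longrightarrow> (\<phi> ^^ n) x = \<one>"
    show "inj_on \<phi> ((\<phi> ^^ n) ` carrier G)"
    proof (rule inj_onI, clarify)
      fix x y assume xy: "x \<in> carrier G" "y \<in> carrier G" "\<phi> ((\<phi> ^^ n) x) = \<phi> ((\<phi> ^^ n) y)"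
      then have "\<phi> ((\<phi> ^^ n) (x \<otimes> inv y)) = \<one>"
        by simp
      then have "(\<phi> ^^ n) (x \<otimes> inv y) = \<one>"
        using * xy by blast
      then show "(\<phi> ^^ n) x = (\<phi> ^^ n) y"
        using xy inv_equality[of "(\<phi> ^^ n) x" "inv ((\<phi> ^^ n) y)"] by simp
    qed
  qed
  then show ?thesis
    by (simp add: SH_exponent_def)
qed

end

lemma torsion_set_hom:
  assumes "comm_group G" "comm_group H" "h \<in> hom G H" "x \<in> torsion_set G"
  shows "h x \<in> torsion_set H"
proof -
  interpret G: comm_group G by fact
  interpret H: comm_group H by fact
  interpret h: group_hom G H h
    using assms by (simp add: group_hom_def group_hom_axioms_def G.group_axioms H.group_axioms)
  from assms(4) obtain n :: nat where n: "n > 0" "x [^]\<^bsub>G\<^esub> n = \<one>\<^bsub>G\<^esub>" and x: "x \<in> carrier G"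
    by (auto simp: torsion_set_def)
  have "h x [^]\<^bsub>H\<^esub> n = \<one>\<^bsub>H\<^esub>"
    using n x by (metis h.hom_nat_pow h.hom_one)
  then show ?thesis
    using n x by (auto simp: torsion_set_def)
qed

section \<open>Groups of torsion-free rank one\<close>

text \<open>
  Rank one in the form used below: there is an element of infinite order, and any two elements
  are linearly dependent.
\<close>

lemma rank_one:
  assumes "comm_group A" "has_torsion_free_rank A 1"
  shows rank_one_nontorsion: "\<exists>b \<in> carrier A. b \<notin> torsion_set A"
    and rank_one_dependent: "x \<in> carrier A \<Longrightarrow> y \<in> carrier A \<Longrightarrow>
      \<exists>(u::int) (v::int). (u \<noteq> 0 \<or> v \<noteq> 0) \<and> x [^]\<^bsub>A\<^esub> u \<otimes>\<^bsub>A\<^esub> y [^]\<^bsub>A\<^esub> v = \<one>\<^bsub>A\<^esub>"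
proof -
  interpret comm_group A by fact
  from assms(2) obtain B where B: "int_independent A B" "\<forall>C. int_independent A C \<and> B \<subseteq> C \<longrightarrow> C = B"
    "finite B" "card B = 1"
    unfolding has_torsion_free_rank_def by blast
  from B(4) obtain b where b: "B = {b}"
    by (metis card_1_singletonE)
  have bc: "b \<in> carrier A"
    using B b by (auto simp: int_independent_def)
  have b0: "c = 0" if "b [^]\<^bsub>A\<^esub> (c::int) = \<one>\<^bsub>A\<^esub>" for c
  proof -
    have *: "(\<Otimes>\<^bsub>A\<^esub>x\<in>{b}. x [^]\<^bsub>A\<^esub> c) = \<one>\<^bsub>A\<^esub>"
      using that bc by (subst finprod_insert) (auto simp: Pi_iff)
    have "\<forall>F (c :: 'a \<Rightarrow> int). finite F \<and> F \<subseteq> B \<and> (\<Otimes>\<^bsub>A\<^esub>x\<in>F. x [^]\<^bsub>A\<^esub> c x) = \<one>\<^bsub>A\<^esub>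
        \<longrightarrow> (\<forall>x\<in>F. c x = 0)"
      using B(1) unfolding int_independent_def by (rule conjunct2)
    from this[THEN spec[of _ "{b}"], THEN spec[of _ "\<lambda>_. c"]] show ?thesis
      using b * by simp
  qed
  have dep: "\<exists>(n::int) (c::int). n \<noteq> 0 \<and> x [^]\<^bsub>A\<^esub> n = b [^]\<^bsub>A\<^esub> c" if x: "x \<in> carrier A" for x
  proof (cases "x = b")
    case True
    then show ?thesis by (intro exI[of _ "1::int"] conjI) simp_all
  next
    case False
    have "\<not> int_independent A {b, x}"
      using B(2)[THEN spec[of _ "{b, x}"]] b False by auto
    then have "\<not> (\<forall>F (c :: 'a \<Rightarrow> int). finite F \<and> F \<subseteq> {b, x} \<and>
        (\<Otimes>\<^bsub>A\<^esub>z\<in>F. z [^]\<^bsub>A\<^esub> c z) = \<one>\<^bsub>A\<^esub> \<longrightarrow> (\<forall>z\<in>F. c z = 0))"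
      unfolding int_independent_def using x bc by simp
    then obtain F and c :: "'a \<Rightarrow> int" where F: "F \<subseteq> {b, x}" "(\<Otimes>\<^bsub>A\<^esub>z\<in>F. z [^]\<^bsub>A\<^esub> c z) = \<one>\<^bsub>A\<^esub>"
      "\<exists>z\<in>F. c z \<noteq> 0"
      by (simp only: not_all not_imp) (elim exE conjE, simp)
    define d where "d z = (if z \<in> F then c z else 0)" for z
    have "(\<Otimes>\<^bsub>A\<^esub>z\<in>{b,x}. z [^]\<^bsub>A\<^esub> d z) = (\<Otimes>\<^bsub>A\<^esub>z\<in>F. z [^]\<^bsub>A\<^esub> c z)"
      by (rule finprod_mono_neutral_cong_right) (use F x bc in \<open>auto simp: d_def\<close>)
    then have *: "b [^]\<^bsub>A\<^esub> d b \<otimes>\<^bsub>A\<^esub> x [^]\<^bsub>A\<^esub> d x = \<one>\<^bsub>A\<^esub>"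
      using F False x bc by (simp add: Pi_iff)
    have "d x \<noteq> 0"
    proof
      assume 0: "d x = 0"
      then have "d b = 0" using * bc b0 by simp
      then show False using 0 F by (auto simp: d_def split: if_splits)
    qed
    moreover have "x [^]\<^bsub>A\<^esub> d x = b [^]\<^bsub>A\<^esub> (- d b)"
      using * x bc by (metis int_pow_closed int_pow_neg inv_equality m_comm)
    ultimately show ?thesis by blast
  qed
  show "\<exists>b \<in> carrier A. b \<notin> torsion_set A"
    using b0 bc by (auto simp: torsion_set_int)
  assume xy: "x \<in> carrier A" "y \<in> carrier A"
  obtain n c m d :: int where *: "n \<noteq> 0" "x [^]\<^bsub>A\<^esub> n = b [^]\<^bsub>A\<^esub> c" "m \<noteq> 0" "y [^]\<^bsub>A\<^esub> m = b [^]\<^bsub>A\<^esub> d"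
    by (meson dep xy)
  show "\<exists>(u::int) (v::int). (u \<noteq> 0 \<or> v \<noteq> 0) \<and> x [^]\<^bsub>A\<^esub> u \<otimes>\<^bsub>A\<^esub> y [^]\<^bsub>A\<^esub> v = \<one>\<^bsub>A\<^esub>"
  proof (cases "c = 0")
    case True
    then show ?thesis using * by (intro exI[of _ n] exI[of _ 0]) simp
  next
    case False
    have "x [^]\<^bsub>A\<^esub> (n * d) = b [^]\<^bsub>A\<^esub> (c * d)" "y [^]\<^bsub>A\<^esub> (m * (- c)) = b [^]\<^bsub>A\<^esub> (d * (- c))"
      using * xy bc int_pow_pow by metis+
    then have "x [^]\<^bsub>A\<^esub> (n * d) \<otimes>\<^bsub>A\<^esub> y [^]\<^bsub>A\<^esub> (m * (- c)) = b [^]\<^bsub>A\<^esub> (c * d + d * (- c))"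
      using bc by (simp only: int_pow_mult)
    then have "x [^]\<^bsub>A\<^esub> (n * d) \<otimes>\<^bsub>A\<^esub> y [^]\<^bsub>A\<^esub> (m * (- c)) = \<one>\<^bsub>A\<^esub>"
      by (simp add: mult.commute)
    moreover have "m * (- c) \<noteq> 0" using False * by simp
    ultimately show ?thesis by blast
  qed
qed

text \<open>
  A homomorphism from a group of rank one that is nonzero modulo torsion is injective modulo
  torsion.
\<close>

lemma rank_one_hom:
  assumes "comm_group A" "has_torsion_free_rank A 1" "comm_group B" "h \<in> hom A B"
    and "a \<in> carrier A" "h a \<notin> torsion_set B" "x \<in> carrier A" "x \<notin> torsion_set A"
  shows "h x \<notin> torsion_set B"
proof
  assume hx: "h x \<in> torsion_set B"
  interpret A: comm_group A by fact
  interpret B: comm_group B by fact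
  interpret h: group_hom A B h
    using assms by (simp add: group_hom_def group_hom_axioms_def A.group_axioms B.group_axioms)
  obtain u v :: int where uv: "u \<noteq> 0 \<or> v \<noteq> 0" "x [^]\<^bsub>A\<^esub> u \<otimes>\<^bsub>A\<^esub> a [^]\<^bsub>A\<^esub> v = \<one>\<^bsub>A\<^esub>"
    using rank_one_dependent[OF assms(1,2,7,5)] by blast
  have "v \<noteq> 0"
    using uv assms(7,8) by (auto simp: A.torsion_set_int)
  have "h x [^]\<^bsub>B\<^esub> u \<otimes>\<^bsub>B\<^esub> h a [^]\<^bsub>B\<^esub> v = \<one>\<^bsub>B\<^esub>"
    using uv assms(5,7) by (metis A.int_pow_closed h.hom_int_pow h.hom_mult h.hom_one)
  then have "h a [^]\<^bsub>B\<^esub> v = inv\<^bsub>B\<^esub> (h x [^]\<^bsub>B\<^esub> u)"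
    using assms(5,7) by (metis A.int_pow_closed B.inv_equality B.m_comm h.hom_closed B.int_pow_closed)
  also have "\<dots> \<in> torsion_set B"
    using hx B.subgroup_torsion_set by (simp add: subgroup.m_inv_closed B.subgroup_int_pow_closed)
  finally show False
    using \<open>v \<noteq> 0\<close> assms(5,6) by (simp add: B.torsion_set_pow_iff)
qed

lemma precsim_trans:
  assumes "A \<precsim> B" "B \<precsim> C" "comm_group B" "has_torsion_free_rank B 1" "comm_group C"
  shows "A \<precsim> C"
proof -
  obtain f a where f: "f \<in> hom A B" "a \<in> carrier A" "f a \<notin> torsion_set B"
    using assms(1) unfolding precsim_def by blast
  obtain g b where g: "g \<in> hom B C" "b \<in> carrier B" "g b \<notin> torsion_set C"
    using assms(2) unfolding precsim_def by blast
  have "f a \<in> carrier B"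
    using f by (auto simp: hom_def)
  then have "g (f a) \<notin> torsion_set C"
    using rank_one_hom[OF assms(3-5) g(1,2,3)] f(3) by blast
  moreover have "g \<circ> f \<in> hom A C"
    using f(1) g(1) by (rule hom_compose)
  ultimately show ?thesis
    unfolding precsim_def using f(2) by (intro bexI[of _ "g \<circ> f"]) auto
qed

lemma precsim_refl:
  assumes "comm_group A" "has_torsion_free_rank A 1"
  shows "A \<precsim> A"
proof -
  obtain b where "b \<in> carrier A" "b \<notin> torsion_set A"
    using rank_one_nontorsion[OF assms] by blast
  moreover have "id \<in> hom A A" by (simp add: hom_def)
  ultimately show ?thesis
    unfolding precsim_def by (intro bexI[of _ id]) auto
qed

section \<open>Integer relations modulo isolated subgroups\<close>

context comm_group
begin

lemma finprod_mem_subgroup: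
  assumes "subgroup S G" "\<And>k. k \<in> K \<Longrightarrow> f k \<in> S"
  shows "finprod G f K \<in> S"
  using assms(2)
proof (induction K rule: infinite_finite_induct)
  case (insert k K)
  have "f \<in> K \<rightarrow> carrier G" "f k \<in> carrier G"
    using insert.prems subgroup.subset[OF assms(1)] by blast+
  then show ?case
    using insert by (simp add: subgroup.m_closed[OF assms(1)])
qed (simp_all add: subgroup.one_closed[OF assms(1)])

lemma subgroup_mult_cancel:
  assumes "subgroup S G" "x \<in> carrier G" "y \<in> S" "x \<otimes> y \<in> S"
  shows "x \<in> S"
proof -
  have "y \<in> carrier G" using assms(1,3) by (rule subgroup.mem_carrier)
  then have "x = (x \<otimes> y) \<otimes> inv y" using assms(2) by (simp add: m_assoc)
  moreover have "(x \<otimes> y) \<otimes> inv y \<in> S"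
    by (rule subgroup.m_closed[OF assms(1,4) subgroup.m_inv_closed[OF assms(1,3)]])
  ultimately show ?thesis by metis
qed

lemma hom_finprod:
  assumes "h \<in> hom G G" "f \<in> K \<rightarrow> carrier G"
  shows "h (finprod G f K) = (\<Otimes>k\<in>K. h (f k))"
proof -
  interpret h: group_hom G G h
    using assms by (simp add: group_hom_def group_hom_axioms_def)
  show ?thesis
    using assms(2) by (induction K rule: infinite_finite_induct) (simp_all add: Pi_iff)
qed

lemma finprod_int_pow_const:
  assumes "x \<in> carrier G" "finite K"
  shows "(\<Otimes>k\<in>K. x [^] (c k :: int)) = x [^] (\<Sum>k\<in>K. c k)"
  using assms(2,1) by induction (simp_all add: int_pow_mult)

text \<open>
  Gaussian elimination over the integers: if any two elements are dependent modulo each of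
  the isolated subgroups \<open>P i\<close> (that is, the torsion-free quotient by \<open>P i\<close> has rank at
  most one), then more than \<open>card E\<close> elements satisfy a nontrivial integer relation modulo
  the intersection of the \<open>P i\<close>.
\<close>

lemma integer_relation:
  assumes "finite E"
    and "\<And>i. i \<in> E \<Longrightarrow> subgroup (P i) G"
    and "\<And>i x n. i \<in> E \<Longrightarrow> x \<in> carrier G \<Longrightarrow> n \<noteq> 0 \<Longrightarrow> x [^] (n::int) \<in> P i \<Longrightarrow> x \<in> P i"
    and "\<And>i x y. i \<in> E \<Longrightarrow> x \<in> carrier G \<Longrightarrow> y \<in> carrier G \<Longrightarrow>
      \<exists>(u::int) (v::int). (u \<noteq> 0 \<or> v \<noteq> 0) \<and> x [^] u \<otimes> y [^] v \<in> P i"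
    and "finite K" "card E < card K" "w \<in> K \<rightarrow> carrier G"
  shows "\<exists>c :: 'k \<Rightarrow> int. (\<exists>k\<in>K. c k \<noteq> 0) \<and> (\<forall>i\<in>E. (\<Otimes>k\<in>K. w k [^] c k) \<in> P i)"
  using assms
proof (induction E arbitrary: K w rule: finite_induct)
  case empty
  then obtain k where "k \<in> K" by fastforce
  then show ?case by (intro exI[of _ "\<lambda>_. 1"]) auto
next
  case (insert i E)
  have w: "w k \<in> carrier G" if "k \<in> K" for k
    using insert.prems(6) that by blast
  have IH: "\<exists>c :: 'k \<Rightarrow> int. (\<exists>k\<in>K. c k \<noteq> 0) \<and> (\<forall>i\<in>E. (\<Otimes>k\<in>K. w k [^] c k) \<in> P i)"
    if "finite K" "card E < card K" "w \<in> K \<rightarrow> carrier G" for K w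
    by (rule insert.IH[OF _ _ _ that]) (assumption | rule insertI2 insert.prems(1-3))+
  have sub: "subgroup (P i) G"
    by (rule insert.prems(1)[OF insertI1])
  show ?case
  proof (cases "\<forall>k\<in>K. w k \<in> P i")
    case True
    have "card E < card K" using insert.prems(5) insert.hyps by simp
    then obtain c :: "'k \<Rightarrow> int" where c: "\<exists>k\<in>K. c k \<noteq> 0" "\<forall>i\<in>E. (\<Otimes>k\<in>K. w k [^] c k) \<in> P i"
      using IH[OF insert.prems(4) _ insert.prems(6)] by auto
    have "(\<Otimes>k\<in>K. w k [^] c k) \<in> P i"
      using True by (intro finprod_mem_subgroup[OF sub] subgroup_int_pow_closed[OF sub]) blast
    with c show ?thesis by (intro exI[of _ c]) simp
  next
    case False
    then obtain k0 where k0: "k0 \<in> K" "w k0 \<notin> P i" by blast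
    have "\<exists>(u::int) (v::int). u \<noteq> 0 \<and> w k [^] u \<otimes> w k0 [^] v \<in> P i" if k: "k \<in> K" for k
    proof -
      obtain u v :: int where uv: "u \<noteq> 0 \<or> v \<noteq> 0" "w k [^] u \<otimes> w k0 [^] v \<in> P i"
        using insert.prems(3)[OF insertI1 w[OF k] w[OF k0(1)]] by auto
      have "u \<noteq> 0"
      proof
        assume "u = 0"
        with uv w k0 have "v \<noteq> 0" "w k0 [^] v \<in> P i" by auto
        then show False using insert.prems(2)[OF insertI1 w[OF k0(1)]] k0(2) by simp
      qed
      with uv show ?thesis by blast
    qed
    then obtain u v :: "'k \<Rightarrow> int"
      where u: "\<And>k. k \<in> K \<Longrightarrow> u k \<noteq> 0" and uv: "\<And>k. k \<in> K \<Longrightarrow> w k [^] u k \<otimes> w k0 [^] v k \<in> P i"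
      by metis
    define K' where "K' = K - {k0}"
    \<comment> \<open>The pivot \<open>w k0\<close> clears the coordinate \<open>i\<close> of the remaining elements.\<close>
    define w' where "w' k = w k [^] u k \<otimes> w k0 [^] v k" for k
    have K': "finite K'" "card E < card K'" "K' \<subseteq> K" "K = insert k0 K'" "k0 \<notin> K'"
      using insert.prems(4,5) insert.hyps k0 by (auto simp: K'_def)
    have w': "w' \<in> K' \<rightarrow> carrier G"
      using w k0 K' by (auto simp: w'_def)
    obtain c :: "'k \<Rightarrow> int" where c: "\<exists>k\<in>K'. c k \<noteq> 0" "\<forall>i\<in>E. (\<Otimes>k\<in>K'. w' k [^] c k) \<in> P i"
      using IH[OF K'(1,2) w'] by auto
    define d where "d k = (if k = k0 then (\<Sum>k\<in>K'. v k * c k) else u k * c k)" for k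
    have "(\<Otimes>k\<in>K. w k [^] d k) = w k0 [^] d k0 \<otimes> (\<Otimes>k\<in>K'. w k [^] d k)"
      unfolding K'(4) by (rule finprod_insert) (use K' w k0 in auto)
    also have "(\<Otimes>k\<in>K'. w k [^] d k) = (\<Otimes>k\<in>K'. w k [^] (u k * c k))"
      by (rule finprod_cong') (use K' w in \<open>auto simp: d_def\<close>)
    also have "w k0 [^] d k0 = (\<Otimes>k\<in>K'. w k0 [^] (v k * c k))"
      using K' w k0 by (simp add: d_def finprod_int_pow_const)
    also have "(\<Otimes>k\<in>K'. w k0 [^] (v k * c k)) \<otimes> (\<Otimes>k\<in>K'. w k [^] (u k * c k))
        = (\<Otimes>k\<in>K'. w k0 [^] (v k * c k) \<otimes> w k [^] (u k * c k))"
      by (rule finprod_multf[symmetric]) (use K' w k0 in auto)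
    also have "\<dots> = (\<Otimes>k\<in>K'. w' k [^] c k)"
    proof (rule finprod_cong')
      show "w k0 [^] (v k * c k) \<otimes> w k [^] (u k * c k) = w' k [^] c k" if "k \<in> K'" for k
        using that K' w k0 by (simp add: w'_def int_pow_distrib int_pow_pow m_comm subset_iff)
    qed (use w' in auto)
    finally have eq: "(\<Otimes>k\<in>K. w k [^] d k) = (\<Otimes>k\<in>K'. w' k [^] c k)" .
    have "(\<Otimes>k\<in>K'. w' k [^] c k) \<in> P i"
      using uv K'(3)
      by (intro finprod_mem_subgroup[OF sub] subgroup_int_pow_closed[OF sub]) (auto simp: w'_def)
    moreover obtain k where k: "k \<in> K'" "c k \<noteq> 0"
      using c(1) by blast
    moreover from k have "k \<in> K" "d k \<noteq> 0"
      using u[of k] K'(3,5) by (auto simp: d_def)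
    ultimately show ?thesis
      using c(2) eq by (intro exI[of _ d]) auto
  qed
qed

text \<open>
  Consequently an endomorphism that is nilpotent at \<open>y\<close> modulo \<open>Q\<close>, on a quotient \<open>V / Q\<close>
  which is torsion-free of rank at most \<open>card E\<close>, kills \<open>y\<close> after \<open>card E\<close> steps.
\<close>

lemma nilpotent_within_rank:
  assumes \<phi>: "\<phi> \<in> hom G G" and E: "finite E"
    and P: "\<And>i. i \<in> E \<Longrightarrow> subgroup (P i) G"
    and iso: "\<And>i x n. i \<in> E \<Longrightarrow> x \<in> carrier G \<Longrightarrow> n \<noteq> 0 \<Longrightarrow> x [^] (n::int) \<in> P i \<Longrightarrow> x \<in> P i"
    and rank: "\<And>i x y. i \<in> E \<Longrightarrow> x \<in> carrier G \<Longrightarrow> y \<in> carrier G \<Longrightarrow>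
      \<exists>(u::int) (v::int). (u \<noteq> 0 \<or> v \<noteq> 0) \<and> x [^] u \<otimes> y [^] v \<in> P i"
    and V: "subgroup V G" "\<And>x. x \<in> V \<Longrightarrow> \<phi> x \<in> V"
    and Q: "subgroup Q G" "\<And>x. x \<in> Q \<Longrightarrow> \<phi> x \<in> Q"
    and Q_iso: "\<And>x n. x \<in> carrier G \<Longrightarrow> n \<noteq> 0 \<Longrightarrow> x [^] (n::int) \<in> Q \<Longrightarrow> x \<in> Q"
    and VQ: "\<And>x. x \<in> V \<Longrightarrow> (\<And>i. i \<in> E \<Longrightarrow> x \<in> P i) \<Longrightarrow> x \<in> Q"
    and y: "y \<in> V" "(\<phi> ^^ m) y \<in> Q"
  shows "(\<phi> ^^ card E) y \<in> Q"
proof -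
  have Q_pow: "(\<phi> ^^ k) x \<in> Q" if "x \<in> Q" for k x
    by (induction k) (simp_all add: that Q(2))
  have Q_le: "(\<phi> ^^ l) y \<in> Q" if "(\<phi> ^^ k) y \<in> Q" "k \<le> l" for k l
  proof -
    have "(\<phi> ^^ l) y = (\<phi> ^^ (l - k)) ((\<phi> ^^ k) y)"
      by (metis that(2) funpow_add comp_apply le_add_diff_inverse2)
    then show ?thesis using Q_pow[OF that(1)] by simp
  qed
  have yV: "(\<phi> ^^ k) y \<in> V" for k
    by (induction k) (simp_all add: y(1) V(2))
  have yc: "(\<phi> ^^ k) y \<in> carrier G" for k
    by (rule subgroup.mem_carrier[OF V(1) yV])
  define n where "n = (LEAST k. (\<phi> ^^ k) y \<in> Q)"
  have nQ: "(\<phi> ^^ n) y \<in> Q"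
    unfolding n_def using y(2) by (rule LeastI)
  have "n \<le> card E"
  proof (rule ccontr)
    assume "\<not> n \<le> card E"
    then have card: "card E < card {..<n}" by simp
    have "\<exists>c :: nat \<Rightarrow> int. (\<exists>k\<in>{..<n}. c k \<noteq> 0) \<and>
        (\<forall>i\<in>E. (\<Otimes>k\<in>{..<n}. (\<phi> ^^ k) y [^] c k) \<in> P i)"
      by (rule integer_relation[OF E _ _ _ finite_lessThan card])
        (assumption | rule P iso rank | simp add: yc)+
    then obtain c :: "nat \<Rightarrow> int" where c: "\<exists>k\<in>{..<n}. c k \<noteq> 0"
      "\<forall>i\<in>E. (\<Otimes>k\<in>{..<n}. (\<phi> ^^ k) y [^] c k) \<in> P i"
      by (elim exE conjE)
    \<comment> \<open>Applying the power \<open>r\<close> of \<open>\<phi>\<close> to the relation moves every term after the first nonzero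
      one, number \<open>k0\<close>, into \<open>Q\<close>, while that term itself becomes a multiple of
      \<open>(\<phi> ^^ (n - 1)) y\<close>.\<close>
    define k0 where "k0 = (LEAST k. k < n \<and> c k \<noteq> 0)"
    have k0: "k0 < n" "c k0 \<noteq> 0"
      using c(1) LeastI_ex[of "\<lambda>k. k < n \<and> c k \<noteq> 0"] unfolding k0_def by auto
    have k0_least: "c k = 0" if "k < k0" for k
      using that not_less_Least[of k "\<lambda>k. k < n \<and> c k \<noteq> 0"] k0(1) unfolding k0_def by auto
    define r where "r = n - Suc k0"
    define z where "z = (\<Otimes>k\<in>{..<n}. (\<phi> ^^ k) y [^] c k)"
    interpret h: group_hom G G "\<phi> ^^ r"
      using hom_funpow[OF \<phi>] by (simp add: group_hom_def group_hom_axioms_def)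
    have "z \<in> V"
      unfolding z_def by (intro finprod_mem_subgroup[OF V(1)] subgroup_int_pow_closed[OF V(1)] yV)
    then have "z \<in> Q"
      using c(2) VQ unfolding z_def by blast
    then have "(\<phi> ^^ r) z \<in> Q" by (rule Q_pow)
    also have "(\<phi> ^^ r) z = (\<Otimes>k\<in>{..<n}. (\<phi> ^^ (r + k)) y [^] c k)"
      unfolding z_def using yc
      by (subst hom_finprod[OF hom_funpow[OF \<phi>]]) (auto simp: h.hom_int_pow funpow_add)
    also have "\<dots> = (\<phi> ^^ (r + k0)) y [^] c k0 \<otimes> (\<Otimes>k\<in>{..<n} - {k0}. (\<phi> ^^ (r + k)) y [^] c k)"
      using k0(1) yc by (subst finprod_insert[symmetric]) (auto simp: insert_absorb)
    finally have total: "(\<phi> ^^ (r + k0)) y [^] c k0 \<otimes> (\<Otimes>k\<in>{..<n} - {k0}. (\<phi> ^^ (r + k)) y [^] c k) \<in> Q" .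
    have "(\<Otimes>k\<in>{..<n} - {k0}. (\<phi> ^^ (r + k)) y [^] c k) \<in> Q"
    proof (rule finprod_mem_subgroup[OF Q(1)])
      fix k assume k: "k \<in> {..<n} - {k0}"
      show "(\<phi> ^^ (r + k)) y [^] c k \<in> Q"
      proof (cases "k < k0")
        case True
        then show ?thesis using k0_least subgroup.one_closed[OF Q(1)] by simp
      next
        case False
        with k k0(1) have "n \<le> r + k" by (auto simp: r_def)
        then show ?thesis using Q_le[OF nQ] subgroup_int_pow_closed[OF Q(1)] by blast
      qed
    qed
    then have "(\<phi> ^^ (r + k0)) y [^] c k0 \<in> Q"
      using subgroup_mult_cancel[OF Q(1) int_pow_closed[OF yc] _ total] by blast
    then have "(\<phi> ^^ (r + k0)) y \<in> Q"
      using Q_iso k0(2) yc by blast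
    then have "n \<le> r + k0"
      unfolding n_def by (rule Least_le)
    with k0(1) show False by (simp add: r_def)
  qed
  then show ?thesis using Q_le nQ by blast
qed

end

section \<open>Direct sums of groups of rank one\<close>

lemma (in group_hom) subgroup_vimage:
  assumes "subgroup S H"
  shows "subgroup {x \<in> carrier G. h x \<in> S} G"
proof -
  interpret S: subgroup S H by fact
  show ?thesis
    by (rule G.subgroupI) (auto intro: exI[of _ "\<one>\<^bsub>G\<^esub>"])
qed

text \<open>A family of groups of torsion-free rank one and its direct sum \<open>D\<close>.\<close>

locale rank_one_sum =
  fixes I :: "'i set" and A :: "'i \<Rightarrow> ('a, 'm) monoid_scheme"
  assumes comm: "\<And>i. i \<in> I \<Longrightarrow> comm_group (A i)"
    and rank: "\<And>i. i \<in> I \<Longrightarrow> has_torsion_free_rank (A i) 1"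
begin

abbreviation D :: "('i \<Rightarrow> 'a) monoid" where
  "D \<equiv> sum_group I A"

lemma grp: "i \<in> I \<Longrightarrow> group (A i)"
  using comm by (simp add: comm_group_def)

lemma one_closed: "i \<in> I \<Longrightarrow> \<one>\<^bsub>A i\<^esub> \<in> carrier (A i)"
  using grp by (simp add: group.is_monoid monoid.one_closed)

lemma l_one: "i \<in> I \<Longrightarrow> a \<in> carrier (A i) \<Longrightarrow> \<one>\<^bsub>A i\<^esub> \<otimes>\<^bsub>A i\<^esub> a = a"
  using grp by (simp add: group.is_monoid monoid.l_one)

lemma r_one: "i \<in> I \<Longrightarrow> a \<in> carrier (A i) \<Longrightarrow> a \<otimes>\<^bsub>A i\<^esub> \<one>\<^bsub>A i\<^esub> = a"
  using grp by (simp add: group.is_monoid monoid.r_one)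

lemma carrier_D:
  "carrier D = {x \<in> \<Pi>\<^sub>E i\<in>I. carrier (A i). finite {i \<in> I. x i \<noteq> \<one>\<^bsub>A i\<^esub>}}"
  using carrier_sum_group grp by blast

lemma component_closed: "x \<in> carrier D \<Longrightarrow> i \<in> I \<Longrightarrow> x i \<in> carrier (A i)"
  by (auto simp: carrier_D)

lemma D_eqI:
  assumes "x \<in> carrier D" "y \<in> carrier D" "\<And>i. i \<in> I \<Longrightarrow> x i = y i"
  shows "x = y"
  using assms by (auto simp: carrier_D PiE_def intro: extensionalityI)

lemma comm_group_D: "comm_group D"
proof (rule group.group_comm_groupI)
  show "group D" by (simp add: grp)
  fix x y assume "x \<in> carrier D" "y \<in> carrier D"
  then have "x i \<otimes>\<^bsub>A i\<^esub> y i = y i \<otimes>\<^bsub>A i\<^esub> x i" if "i \<in> I" for i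
    using that comm[OF that] component_closed
    by (simp add: comm_group.axioms(1) comm_monoid.m_comm)
  then show "x \<otimes>\<^bsub>D\<^esub> y = y \<otimes>\<^bsub>D\<^esub> x"
    by (simp add: restrict_def fun_eq_iff)
qed

sublocale D: comm_group D
  by (rule comm_group_D)

text \<open>The inclusion of the summand \<open>A i\<close>.\<close>

definition embed :: "'i \<Rightarrow> 'a \<Rightarrow> 'i \<Rightarrow> 'a" where
  "embed i a = (\<lambda>j\<in>I. if j = i then a else \<one>\<^bsub>A j\<^esub>)"

lemma embed_closed: "i \<in> I \<Longrightarrow> a \<in> carrier (A i) \<Longrightarrow> embed i a \<in> carrier D"
  by (auto simp: carrier_D embed_def one_closed intro: finite_subset[of _ "{i}"])

lemma embed_hom: "i \<in> I \<Longrightarrow> embed i \<in> hom (A i) D"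
  by (intro homI embed_closed) (auto simp: embed_def one_closed l_one)

lemma embed_one: "embed i \<one>\<^bsub>A i\<^esub> = \<one>\<^bsub>D\<^esub>"
  by (auto simp: embed_def)

lemma component_hom: "i \<in> I \<Longrightarrow> (\<lambda>x. x i) \<in> hom D (A i)"
  by (intro homI component_closed) auto

lemma mem_subgroup_if_components:
  assumes S: "subgroup S D" and x: "x \<in> carrier D" and "\<And>i. i \<in> I \<Longrightarrow> embed i (x i) \<in> S"
  shows "x \<in> S"
proof -
  have "x \<in> S" if "finite F" "{i \<in> I. x i \<noteq> \<one>\<^bsub>A i\<^esub>} \<subseteq> F" "x \<in> carrier D"
    "\<And>i. i \<in> I \<Longrightarrow> embed i (x i) \<in> S" for F x
    using that
  proof (induction F arbitrary: x rule: finite_induct)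
    case empty
    then have "x = \<one>\<^bsub>D\<^esub>"
      by (intro D_eqI[OF _ D.one_closed]) auto
    then show ?case using subgroup.one_closed[OF S] by (simp only:)
  next
    case (insert i F)
    show ?case
    proof (cases "i \<in> I")
      case False
      then have "{i \<in> I. x i \<noteq> \<one>\<^bsub>A i\<^esub>} \<subseteq> F"
        using insert.prems(1) by auto
      then show ?thesis
        using insert.IH insert.prems(2,3) by blast
    next
      case True
      define y where "y = (\<lambda>j\<in>I. if j = i then \<one>\<^bsub>A i\<^esub> else x j)"
      have fin: "finite {i \<in> I. x i \<noteq> \<one>\<^bsub>A i\<^esub>}"
        using insert.prems(2) by (simp add: carrier_D)
      have y: "y \<in> carrier D"
        unfolding carrier_D y_def
        by (auto intro: finite_subset[OF _ fin] one_closed component_closed[OF insert.prems(2)])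
      have "{j \<in> I. y j \<noteq> \<one>\<^bsub>A j\<^esub>} \<subseteq> F"
        using insert.prems(1) by (auto simp: y_def)
      moreover have "embed j (y j) \<in> S" if "j \<in> I" for j
        using that insert.prems(3)[OF that] subgroup.one_closed[OF S]
        by (cases "j = i") (simp_all add: y_def embed_one del: one_sum_group)
      ultimately have "y \<in> S"
        using insert.IH y by blast
      moreover have "x = embed i (x i) \<otimes>\<^bsub>D\<^esub> y"
      proof (rule D_eqI)
        show "embed i (x i) \<otimes>\<^bsub>D\<^esub> y \<in> carrier D"
          using True y insert.prems(2) by (intro D.m_closed embed_closed component_closed)
        show "x j = (embed i (x i) \<otimes>\<^bsub>D\<^esub> y) j" if "j \<in> I" for j
          using that insert.prems(2) component_closed by (auto simp: embed_def y_def l_one r_one)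
      qed (rule insert.prems)
      ultimately show ?thesis
        using insert.prems(3)[OF True] subgroup.m_closed[OF S] by metis
    qed
  qed
  moreover have "finite {i \<in> I. x i \<noteq> \<one>\<^bsub>A i\<^esub>}"
    using x by (simp add: carrier_D)
  ultimately show ?thesis using assms by blast
qed

lemma torsion_D_iff:
  assumes "x \<in> carrier D"
  shows "x \<in> torsion_set D \<longleftrightarrow> (\<forall>i\<in>I. x i \<in> torsion_set (A i))"
proof
  assume "x \<in> torsion_set D"
  then show "\<forall>i\<in>I. x i \<in> torsion_set (A i)"
    using torsion_set_hom[OF comm_group_D comm component_hom] by blast
next
  assume "\<forall>i\<in>I. x i \<in> torsion_set (A i)"
  then show "x \<in> torsion_set D"
    by (intro mem_subgroup_if_components[OF D.subgroup_torsion_set assms]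
        torsion_set_hom[OF comm comm_group_D embed_hom]) auto
qed

subsection \<open>Subgroups invariant under all endomorphisms\<close>

text \<open>The elements whose components at \<open>J\<close> are torsion.\<close>

definition torsion_at :: "'i set \<Rightarrow> ('i \<Rightarrow> 'a) set" where
  "torsion_at J = {x \<in> carrier D. \<forall>i\<in>J. x i \<in> torsion_set (A i)}"

lemma subgroup_torsion_at:
  assumes "J \<subseteq> I"
  shows "subgroup (torsion_at J) D"
proof -
  have *: "subgroup {x \<in> carrier D. x i \<in> torsion_set (A i)} D" if "i \<in> I" for i
  proof -
    interpret A: comm_group "A i" by (rule comm[OF that])
    interpret h: group_hom D "A i" "\<lambda>x. x i"
      using component_hom[OF that] by (simp add: group_hom_def group_hom_axioms_def A.group_axioms D.group_axioms)
    show ?thesis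
      by (rule h.subgroup_vimage[OF A.subgroup_torsion_set])
  qed
  show ?thesis
  proof (cases "J = {}")
    case True
    then show ?thesis using D.subgroup_self by (simp add: torsion_at_def)
  next
    case False
    then have "torsion_at J = (\<Inter>i\<in>J. {x \<in> carrier D. x i \<in> torsion_set (A i)})"
      by (auto simp: torsion_at_def)
    moreover have "subgroup (\<Inter>i\<in>J. {x \<in> carrier D. x i \<in> torsion_set (A i)}) D"
      by (rule D.subgroups_Inter) (use * assms False in auto)
    ultimately show ?thesis by simp
  qed
qed

lemma component_int_pow:
  assumes "x \<in> carrier D" "i \<in> I"
  shows "(x [^]\<^bsub>D\<^esub> (n::int)) i = x i [^]\<^bsub>A i\<^esub> n"
  using hom_int_pow[OF component_hom[OF assms(2)] assms(1) D.group_axioms grp[OF assms(2)]] .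

lemma torsion_at_isolated:
  assumes "J \<subseteq> I" "x \<in> carrier D" "n \<noteq> 0" "x [^]\<^bsub>D\<^esub> (n::int) \<in> torsion_at J"
  shows "x \<in> torsion_at J"
  unfolding torsion_at_def
proof (intro CollectI conjI ballI)
  fix i assume i: "i \<in> J"
  then have "i \<in> I" using assms(1) by blast
  interpret A: comm_group "A i" by (rule comm[OF \<open>i \<in> I\<close>])
  have "x i [^]\<^bsub>A i\<^esub> n \<in> torsion_set (A i)"
    using assms(4) i component_int_pow[OF assms(2) \<open>i \<in> I\<close>] by (auto simp: torsion_at_def)
  then show "x i \<in> torsion_set (A i)"
    using A.torsion_set_pow_iff[OF component_closed[OF assms(2) \<open>i \<in> I\<close>] assms(3)] by simp
qed (rule assms(2))

lemma torsion_at_rank: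
  assumes "i \<in> I" "x \<in> carrier D" "y \<in> carrier D"
  shows "\<exists>(u::int) (v::int). (u \<noteq> 0 \<or> v \<noteq> 0) \<and>
    x [^]\<^bsub>D\<^esub> u \<otimes>\<^bsub>D\<^esub> y [^]\<^bsub>D\<^esub> v \<in> torsion_at {i}"
proof -
  interpret A: comm_group "A i" by (rule comm[OF assms(1)])
  obtain u v :: int where uv: "u \<noteq> 0 \<or> v \<noteq> 0"
    "x i [^]\<^bsub>A i\<^esub> u \<otimes>\<^bsub>A i\<^esub> y i [^]\<^bsub>A i\<^esub> v = \<one>\<^bsub>A i\<^esub>"
    using rank_one_dependent[OF comm rank component_closed component_closed] assms by blast
  have "(x [^]\<^bsub>D\<^esub> u \<otimes>\<^bsub>D\<^esub> y [^]\<^bsub>D\<^esub> v) i = \<one>\<^bsub>A i\<^esub>"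
    using uv assms component_int_pow by simp
  moreover have "x [^]\<^bsub>D\<^esub> u \<otimes>\<^bsub>D\<^esub> y [^]\<^bsub>D\<^esub> v \<in> carrier D"
    using assms by (intro D.m_closed D.int_pow_closed)
  ultimately show ?thesis
    using uv(1) subgroup.one_closed[OF A.subgroup_torsion_set]
    by (intro exI[of _ u] exI[of _ v]) (simp add: torsion_at_def)
qed

text \<open>
  Sets of indices closed downwards under \<open>\<precsim>\<close>. For such \<open>J\<close> an endomorphism cannot move an
  element of infinite order from outside \<open>J\<close> to a component in \<open>J\<close> without making it torsion,
  so \<open>torsion_at J\<close> is fully invariant.
\<close>

definition down_closed :: "'i set \<Rightarrow> bool" where
  "down_closed J \<longleftrightarrow> J \<subseteq> I \<and> (\<forall>j\<in>J. \<forall>i\<in>I. A i \<precsim> A j \<longrightarrow> i \<in> J)"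

lemma torsion_at_invariant:
  assumes \<phi>: "\<phi> \<in> hom D D" and J: "down_closed J" and x: "x \<in> torsion_at J"
  shows "\<phi> x \<in> torsion_at J"
  unfolding torsion_at_def
proof (intro CollectI conjI ballI)
  have xc: "x \<in> carrier D" using x by (simp add: torsion_at_def)
  then show "\<phi> x \<in> carrier D" using \<phi> by (auto simp: hom_def)
  fix j assume j: "j \<in> J"
  then have jI: "j \<in> I" using J by (auto simp: down_closed_def)
  interpret Aj: comm_group "A j" by (rule comm[OF jI])
  define \<psi> where "\<psi> = (\<lambda>x. x j) \<circ> \<phi>"
  have \<psi>: "\<psi> \<in> hom D (A j)"
    unfolding \<psi>_def using \<phi> component_hom[OF jI] by (rule hom_compose)
  interpret \<psi>: group_hom D "A j" \<psi>
    using \<psi> by (simp add: group_hom_def group_hom_axioms_def Aj.group_axioms D.group_axioms)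
  have "x \<in> {y \<in> carrier D. \<psi> y \<in> torsion_set (A j)}"
  proof (rule mem_subgroup_if_components[OF \<psi>.subgroup_vimage[OF Aj.subgroup_torsion_set] xc])
    fix i assume i: "i \<in> I"
    have e: "embed i (x i) \<in> carrier D"
      using embed_closed component_closed xc i by blast
    have "\<psi> (embed i (x i)) \<in> torsion_set (A j)"
    proof (cases "i \<in> J")
      case True
      then have "x i \<in> torsion_set (A i)" using x by (auto simp: torsion_at_def)
      then show ?thesis
        using torsion_set_hom[OF comm_group_D comm[OF jI] \<psi>]
          torsion_set_hom[OF comm[OF i] comm_group_D embed_hom[OF i]] by blast
    next
      case False
      then have "\<not> A i \<precsim> A j" using J j i by (auto simp: down_closed_def)
      moreover have "\<psi> \<circ> embed i \<in> hom (A i) (A j)"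
        using embed_hom[OF i] \<psi> by (rule hom_compose)
      ultimately have "(\<psi> \<circ> embed i) ` carrier (A i) \<subseteq> torsion_set (A j)"
        unfolding precsim_def by blast
      then show ?thesis using component_closed[OF xc i] by auto
    qed
    with e show "embed i (x i) \<in> {y \<in> carrier D. \<psi> y \<in> torsion_set (A j)}" by simp
  qed
  then show "\<phi> x j \<in> torsion_set (A j)"
    by (simp add: \<psi>_def)
qed

lemma torsion_at_I: "torsion_at I = torsion_set D"
  using torsion_D_iff D.torsion_set_carrier by (auto simp: torsion_at_def)

section \<open>Chains and uniform strong Hopficity\<close>

text \<open>The preorder induced on \<open>I\<close> by \<open>\<precsim>\<close>, and its strict part.\<close>

definition weakly_below :: "'i \<Rightarrow> 'i \<Rightarrow> bool" where
  "weakly_below i j \<longleftrightarrow> i \<in> I \<and> j \<in> I \<and> A i \<precsim> A j"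

definition strictly_below :: "'i \<Rightarrow> 'i \<Rightarrow> bool" where
  "strictly_below i j \<longleftrightarrow> weakly_below i j \<and> \<not> weakly_below j i"

text \<open>
  There is a chain of \<open>n\<close> distinct indices. The chain need not be strict for the preorder:
  it may run through mutually comparable indices.
\<close>

definition has_chain :: "nat \<Rightarrow> bool" where
  "has_chain n \<longleftrightarrow> (\<exists>js. distinct js \<and> set js \<subseteq> I \<and> length js = n \<and>
     (\<forall>k. Suc k < n \<longrightarrow> A (js ! k) \<precsim> A (js ! Suc k)))"

lemma weakly_below_trans: "weakly_below i j \<Longrightarrow> weakly_below j k \<Longrightarrow> weakly_below i k"
  unfolding weakly_below_def using precsim_trans[OF _ _ comm rank comm] by blast

lemma weakly_below_refl: "i \<in> I \<Longrightarrow> weakly_below i i"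
  unfolding weakly_below_def using precsim_refl[OF comm rank] by blast

lemma has_chain_iff:
  "has_chain n \<longleftrightarrow>
    (\<exists>js. distinct js \<and> set js \<subseteq> I \<and> length js = n \<and> sorted_wrt weakly_below js)"
proof -
  have "(\<forall>k. Suc k < n \<longrightarrow> A (js ! k) \<precsim> A (js ! Suc k)) \<longleftrightarrow> sorted_wrt weakly_below js"
    if "set js \<subseteq> I" "length js = n" for js
  proof -
    have I: "js ! k \<in> I" if "k < n" for k
      using that \<open>set js \<subseteq> I\<close> \<open>length js = n\<close> nth_mem by blast
    have "transp weakly_below"
      using weakly_below_trans by (auto intro: transpI)
    then have "sorted_wrt weakly_below js \<longleftrightarrow> successively weakly_below js"
      by (simp add: successively_iff_sorted_wrt_strong successively_conv_sorted_wrt)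
    also have "\<dots> \<longleftrightarrow> (\<forall>k. Suc k < n \<longrightarrow> weakly_below (js ! k) (js ! Suc k))"
      using that(2) by (simp add: successively_conv_nth)
    also have "\<dots> \<longleftrightarrow> (\<forall>k. Suc k < n \<longrightarrow> A (js ! k) \<precsim> A (js ! Suc k))"
      using I by (auto simp: weakly_below_def)
    finally show ?thesis by simp
  qed
  then show ?thesis
    unfolding has_chain_def by metis
qed

text \<open>A class of mutually comparable indices forms a chain in any order.\<close>

lemma has_chain_if_equivalent:
  assumes "E \<subseteq> I" "\<And>i j. i \<in> E \<Longrightarrow> j \<in> E \<Longrightarrow> weakly_below i j" "\<not> (finite E \<and> card E < n)"
  shows "has_chain n"
proof -
  obtain F where F: "F \<subseteq> E" "finite F" "card F = n"
  proof (cases "finite E")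
    case True
    then show ?thesis
      using that assms(3) obtain_subset_with_card_n[of n E] by (metis finite_subset not_less)
  next
    case False
    then show ?thesis
      using that infinite_arbitrarily_large[of E n] by blast
  qed
  obtain js where js: "set js = F" "distinct js"
    using finite_distinct_list[OF F(2)] by blast
  have "sorted_wrt weakly_below js"
    unfolding sorted_wrt_iff_nth_less
    using assms(2) F(1) js(1) by (metis nth_mem order.strict_trans subsetD)
  moreover have "length js = n"
    using js F(3) distinct_card by fastforce
  ultimately show ?thesis
    unfolding has_chain_iff using js F(1) assms(1) by blast
qed

text \<open>The indices at which a strictly ascending chain of \<open>Suc k\<close> indices starts.\<close>

primrec level :: "nat \<Rightarrow> 'i set" where
  "level 0 = I"
| "level (Suc k) = {i \<in> I. \<exists>j\<in>level k. strictly_below i j}"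

lemma level_subset: "level k \<subseteq> I"
  by (cases k) auto

lemma level_antimono: "level (Suc k) \<subseteq> level k"
proof (induction k)
  case (Suc k)
  then show ?case by auto
qed auto

lemma level_down_closed: "down_closed (level k)"
proof (cases k)
  case 0
  then show ?thesis by (simp add: down_closed_def)
next
  case (Suc l)
  have "i \<in> level (Suc l)" if "j \<in> level (Suc l)" "i \<in> I" "A i \<precsim> A j" for i j
  proof -
    from that(1) obtain j' where j': "j' \<in> level l" "strictly_below j j'" "j \<in> I"
      by auto
    have "weakly_below i j"
      using that j' by (simp add: weakly_below_def)
    then have "strictly_below i j'"
      using j'(2) weakly_below_trans unfolding strictly_below_def by blast
    then show ?thesis using that(2) j'(1) by auto
  qed
  then show ?thesis
    using Suc level_subset[of k] unfolding down_closed_def by blast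
qed

lemma level_chain:
  "i \<in> level k \<Longrightarrow> \<exists>js. length js = Suc k \<and> set js \<subseteq> I \<and> sorted_wrt strictly_below js \<and> hd js = i"
proof (induction k arbitrary: i)
  case 0
  then show ?case by (intro exI[of _ "[i]"]) auto
next
  case (Suc k)
  then obtain j where j: "j \<in> level k" "strictly_below i j" by auto
  from Suc.IH[OF j(1)] obtain js where
    js: "length js = Suc k" "set js \<subseteq> I" "sorted_wrt strictly_below js" "hd js = j" by blast
  then obtain js' where js': "js = j # js'"
    by (cases js) auto
  have "strictly_below i l" if "l \<in> set js" for l
  proof (cases "l = j")
    case False
    then have "strictly_below j l" using that js js' by auto
    then show ?thesis using j(2) weakly_below_trans unfolding strictly_below_def by blast
  qed (use j in simp)
  then show ?case
    using js Suc.prems by (intro exI[of _ "i # js"]) auto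
qed

lemma level_empty:
  assumes "\<not> has_chain n" "n > 0"
  shows "level (n - 1) = {}"
proof (rule ccontr)
  assume "level (n - 1) \<noteq> {}"
  then obtain js where js: "length js = n" "set js \<subseteq> I" "sorted_wrt strictly_below js"
    using level_chain[of _ "n - 1"] assms(2) by fastforce
  have "distinct js"
    unfolding distinct_conv_nth
    using js(3) by (metis linorder_neqE_nat sorted_wrt_iff_nth_less strictly_below_def)
  moreover have "sorted_wrt weakly_below js"
    using js(3) by (rule sorted_wrt_mono_rel[rotated]) (simp add: strictly_below_def)
  ultimately show False
    using assms(1) js unfolding has_chain_iff by blast
qed

lemma invariant_funpow_le:
  assumes "\<phi> \<in> hom D D" "down_closed J" "(\<phi> ^^ k) x \<in> torsion_at J" "k \<le> l"
  shows "(\<phi> ^^ l) x \<in> torsion_at J"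
  using assms(4)
proof (induction l rule: dec_induct)
  case (step l)
  then show ?case using torsion_at_invariant[OF assms(1,2)] by simp
qed (rule assms(3))

text \<open>
  Between consecutive levels, the quotient of \<open>torsion_at (level (Suc k))\<close> by
  \<open>torsion_at (level k)\<close> can be treated one class of mutually comparable indices at a time,
  because adding a single class to \<open>level (Suc k)\<close> keeps it down-closed. Such a class has fewer
  than \<open>n\<close> members, which bounds the rank of the corresponding quotient.
\<close>

lemma nilpotent_within_level:
  assumes \<phi>: "\<phi> \<in> hom D D" and n: "\<not> has_chain n"
    and y: "y \<in> torsion_at (level (Suc k))" "(\<phi> ^^ m) y \<in> torsion_at (level k)"
  shows "(\<phi> ^^ n) y \<in> torsion_at (level k)"
proof -
  have yc: "y \<in> carrier D" using y(1) by (simp add: torsion_at_def)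
  have "(\<phi> ^^ n) y i \<in> torsion_set (A i)" if i: "i \<in> level k" for i
  proof (cases "i \<in> level (Suc k)")
    case True
    have "(\<phi> ^^ n) y \<in> torsion_at (level (Suc k))"
      using invariant_funpow_le[OF \<phi> level_down_closed, of 0 y] y(1) by (simp del: level.simps)
    with True show ?thesis by (simp add: torsion_at_def)
  next
    case False
    define E where "E = {j \<in> level k - level (Suc k). weakly_below j i}"
    have iI: "i \<in> I" using i level_subset by blast
    have cls: "weakly_below j' j"
      if "j \<in> level k - level (Suc k)" "j' \<in> level k" "weakly_below j j'" for j j'
      using that by (auto simp: strictly_below_def weakly_below_def)
    have "weakly_below j j'" if "j \<in> E" "j' \<in> E" for j j'
    proof -
      have "weakly_below i j'" using that i cls[of j' i] by (auto simp: E_def)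
      then show ?thesis using that weakly_below_trans[of j i j'] by (auto simp: E_def)
    qed
    moreover have EI: "E \<subseteq> I" using level_subset by (auto simp: E_def)
    ultimately have E: "finite E" "card E < n"
      using has_chain_if_equivalent[of E n] n by blast+
    define J where "J = level (Suc k) \<union> E"
    have JI: "J \<subseteq> I" using EI level_subset[of "Suc k"] by (auto simp: J_def)
    have J: "down_closed J"
      unfolding down_closed_def
    proof (intro conjI ballI impI JI)
      fix j l assume jl: "j \<in> J" "l \<in> I" "A l \<precsim> A j"
      show "l \<in> J"
      proof (cases "j \<in> level (Suc k)")
        case True
        then have "l \<in> level (Suc k)"
          using level_down_closed[of "Suc k"] jl(2,3) unfolding down_closed_def by blast
        then show ?thesis by (simp add: J_def)
      next
        case False
        with jl(1) have jE: "j \<in> level k" "weakly_below j i" by (auto simp: J_def E_def)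
        have "l \<in> level k"
          using level_down_closed[of k] jE(1) jl(2,3) unfolding down_closed_def by blast
        moreover have "weakly_below l i"
          using weakly_below_trans[OF _ jE(2)] jl JI by (auto simp: weakly_below_def)
        ultimately show ?thesis unfolding J_def E_def by blast
      qed
    qed
    have "(\<phi> ^^ card E) y \<in> torsion_at J"
    proof (rule D.nilpotent_within_rank[OF \<phi> E(1), where P = "\<lambda>j. torsion_at {j}"
          and V = "torsion_at (level (Suc k))" and m = m])
      show "subgroup (torsion_at {j}) D" if "j \<in> E" for j
        using that EI by (intro subgroup_torsion_at) blast
      show "x \<in> torsion_at {j}"
        if "j \<in> E" "x \<in> carrier D" "l \<noteq> 0" "x [^]\<^bsub>D\<^esub> (l::int) \<in> torsion_at {j}" for j x l
        using torsion_at_isolated[OF _ that(2-4)] that(1) EI by blast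
      show "\<exists>(u::int) (v::int). (u \<noteq> 0 \<or> v \<noteq> 0) \<and>
          x [^]\<^bsub>D\<^esub> u \<otimes>\<^bsub>D\<^esub> y [^]\<^bsub>D\<^esub> v \<in> torsion_at {j}"
        if "j \<in> E" "x \<in> carrier D" "y \<in> carrier D" for j x y
        by (rule torsion_at_rank[OF subsetD[OF EI that(1)] that(2,3)])
      show "subgroup (torsion_at (level (Suc k))) D"
        by (intro subgroup_torsion_at level_subset)
      show "\<phi> x \<in> torsion_at (level (Suc k))" if "x \<in> torsion_at (level (Suc k))" for x
        by (rule torsion_at_invariant[OF \<phi> level_down_closed that])
      show "subgroup (torsion_at J) D"
        by (rule subgroup_torsion_at[OF JI])
      show "\<phi> x \<in> torsion_at J" if "x \<in> torsion_at J" for x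
        by (rule torsion_at_invariant[OF \<phi> J that])
      show "x \<in> torsion_at J"
        if "x \<in> carrier D" "l \<noteq> 0" "x [^]\<^bsub>D\<^esub> (l::int) \<in> torsion_at J" for x l
        by (rule torsion_at_isolated[OF JI that])
      show "x \<in> torsion_at J"
        if "x \<in> torsion_at (level (Suc k))" "\<And>j. j \<in> E \<Longrightarrow> x \<in> torsion_at {j}" for x
        using that unfolding torsion_at_def J_def by blast
      show "(\<phi> ^^ m) y \<in> torsion_at J"
        using y(2) level_antimono unfolding torsion_at_def J_def E_def by blast
    qed (rule y(1))
    then have "(\<phi> ^^ n) y \<in> torsion_at J"
      using invariant_funpow_le[OF \<phi> J] E(2) by simp
    moreover have "i \<in> J"
      using i False weakly_below_refl[OF iI] unfolding J_def E_def by blast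
    ultimately show ?thesis unfolding torsion_at_def by blast
  qed
  moreover have "(\<phi> ^^ n) y \<in> carrier D"
    using D.hom_funpow[OF \<phi>] yc by (rule hom_in_carrier)
  ultimately show ?thesis by (simp add: torsion_at_def)
qed

lemma torsion_D_funpow_le:
  assumes "\<phi> \<in> hom D D" "(\<phi> ^^ k) x \<in> torsion_set D" "k \<le> l"
  shows "(\<phi> ^^ l) x \<in> torsion_set D"
  using invariant_funpow_le[OF assms(1) _ _ assms(3), of I x] assms(2)
  by (simp add: torsion_at_I down_closed_def)

lemma nilpotent_modulo_torsion:
  assumes \<phi>: "\<phi> \<in> hom D D" and n: "\<not> has_chain n" "n > 0"
    and x: "x \<in> carrier D" "(\<phi> ^^ m) x \<in> torsion_set D"
  shows "(\<phi> ^^ (n * (n - 1))) x \<in> torsion_set D"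
proof -
  have "(\<phi> ^^ (n * k)) y \<in> torsion_set D"
    if "y \<in> torsion_at (level k)" "(\<phi> ^^ m) y \<in> torsion_set D" for k y
    using that
  proof (induction k arbitrary: y)
    case 0
    then show ?case by (simp add: torsion_at_I)
  next
    case (Suc k)
    have "(\<phi> ^^ m) y \<in> torsion_at (level k)"
      using Suc.prems(2) level_subset[of k] unfolding torsion_at_I[symmetric] torsion_at_def by blast
    then have "(\<phi> ^^ n) y \<in> torsion_at (level k)"
      by (rule nilpotent_within_level[OF \<phi> n(1) Suc.prems(1)])
    moreover have "(\<phi> ^^ m) ((\<phi> ^^ n) y) \<in> torsion_set D"
      using torsion_D_funpow_le[OF \<phi> Suc.prems(2), of "m + n"] by (simp add: funpow_add)
    ultimately have "(\<phi> ^^ (n * k)) ((\<phi> ^^ n) y) \<in> torsion_set D"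
      by (rule Suc.IH)
    moreover have "(\<phi> ^^ (n * k)) ((\<phi> ^^ n) y) = (\<phi> ^^ (n * Suc k)) y"
      by (metis add.commute comp_apply funpow_add mult_Suc_right)
    ultimately show ?case by simp
  qed
  moreover have "x \<in> torsion_at (level (n - 1))"
    using level_empty[OF n] x(1) by (simp add: torsion_at_def)
  ultimately show ?thesis using x(2) by blast
qed

end

context comm_group
begin

lemma comm_group_torsion_subgroup: "comm_group (torsion_subgroup G)"
proof (rule group.group_comm_groupI)
  show "group (torsion_subgroup G)"
    using subgroup_torsion_set by (rule subgroup.subgroup_is_group) (rule group_axioms)
qed (simp add: m_comm torsion_set_carrier)

lemma hom_torsion_subgroup:
  assumes "\<phi> \<in> hom G G"
  shows "\<phi> \<in> hom (torsion_subgroup G) (torsion_subgroup G)"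
proof (rule homI)
  fix x y assume "x \<in> carrier (torsion_subgroup G)" "y \<in> carrier (torsion_subgroup G)"
  then show "\<phi> (x \<otimes>\<^bsub>torsion_subgroup G\<^esub> y) = \<phi> x \<otimes>\<^bsub>torsion_subgroup G\<^esub> \<phi> y"
    using hom_mult[OF assms] torsion_set_carrier by simp
qed (use torsion_set_hom[OF comm_group_axioms comm_group_axioms assms] in simp)

text \<open>
  If \<open>N\<close> steps suffice modulo torsion and \<open>e\<close> steps inside the torsion subgroup, then
  \<open>N + e\<close> steps suffice.
\<close>

lemma SH_exponent_extension:
  assumes \<phi>: "\<phi> \<in> hom G G" and e: "SH_exponent (torsion_subgroup G) \<phi> e"
    and N: "\<And>x m. x \<in> carrier G \<Longrightarrow> (\<phi> ^^ m) x \<in> torsion_set G \<Longrightarrow> (\<phi> ^^ N) x \<in> torsion_set G"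
  shows "SH_exponent G \<phi> (N + e)"
proof -
  interpret T: comm_group "torsion_subgroup G" by (rule comm_group_torsion_subgroup)
  have e: "e > 0"
    "\<And>x. x \<in> torsion_set G \<Longrightarrow> (\<phi> ^^ Suc e) x = \<one> \<Longrightarrow> (\<phi> ^^ e) x = \<one>"
    using e unfolding T.SH_exponent_iff[OF hom_torsion_subgroup[OF \<phi>]] by auto
  show ?thesis
    unfolding SH_exponent_iff[OF \<phi>]
  proof (intro conjI ballI impI)
    fix x assume x: "x \<in> carrier G" "(\<phi> ^^ Suc (N + e)) x = \<one>"
    then have "(\<phi> ^^ Suc (N + e)) x \<in> torsion_set G"
      using subgroup.one_closed[OF subgroup_torsion_set] by metis
    then have "(\<phi> ^^ N) x \<in> torsion_set G"
      by (rule N[OF x(1)])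
    moreover have "(\<phi> ^^ Suc e) ((\<phi> ^^ N) x) = \<one>"
      using x(2) by (metis add.commute add_Suc comp_apply funpow_add)
    ultimately have "(\<phi> ^^ e) ((\<phi> ^^ N) x) = \<one>"
      by (rule e(2))
    then show "(\<phi> ^^ (N + e)) x = \<one>"
      by (metis add.commute comp_apply funpow_add)
  qed (use e in simp)
qed

end

context rank_one_sum
begin

lemma uniformly_SH_if_bounded_chains:
  assumes "\<not> has_chain n" "n > 0" "uniformly_strongly_Hopfian (torsion_subgroup D)"
  shows "uniformly_strongly_Hopfian D"
proof -
  obtain e where e: "\<And>\<phi>. \<phi> \<in> hom (torsion_subgroup D) (torsion_subgroup D) \<Longrightarrow>
      SH_exponent (torsion_subgroup D) \<phi> e"
    using assms(3) unfolding uniformly_strongly_Hopfian_def by blast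
  have "SH_exponent D \<phi> (n * (n - 1) + e)" if \<phi>: "\<phi> \<in> hom D D" for \<phi>
    by (rule D.SH_exponent_extension[OF \<phi> e[OF D.hom_torsion_subgroup[OF \<phi>]]
        nilpotent_modulo_torsion[OF \<phi> assms(1,2)]])
  then show ?thesis
    unfolding uniformly_strongly_Hopfian_def by blast
qed

section \<open>Unbounded chains\<close>

text \<open>
  Homomorphisms \<open>g j\<close> from \<open>A (\<tau> j)\<close> to \<open>A j\<close>, for \<open>j\<close> in a set \<open>J\<close> of indices, define an
  endomorphism of the direct sum. Injectivity of \<open>\<tau>\<close> keeps the supports finite.
\<close>

lemma partial_shift_hom:
  assumes J: "J \<subseteq> I" and \<tau>: "inj_on \<tau> J" "\<tau> ` J \<subseteq> I"
    and g: "\<And>j. j \<in> J \<Longrightarrow> g j \<in> hom (A (\<tau> j)) (A j)"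
  shows "(\<lambda>x. \<lambda>j\<in>I. if j \<in> J then g j (x (\<tau> j)) else \<one>\<^bsub>A j\<^esub>) \<in> hom D D" (is "?s \<in> _")
proof (rule homI)
  have \<tau>I: "\<tau> j \<in> I" if "j \<in> J" for j using \<tau>(2) that by blast
  have g_one: "g j \<one>\<^bsub>A (\<tau> j)\<^esub> = \<one>\<^bsub>A j\<^esub>" if "j \<in> J" for j
    using hom_one[OF g[OF that] grp[OF \<tau>I[OF that]] grp] J that by blast
  show "?s x \<in> carrier D" if x: "x \<in> carrier D" for x
  proof -
    have "{j \<in> J. x (\<tau> j) \<noteq> \<one>\<^bsub>A (\<tau> j)\<^esub>} \<subseteq> \<tau> -` {i \<in> I. x i \<noteq> \<one>\<^bsub>A i\<^esub>} \<inter> J"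
      using \<tau>I by auto
    moreover have "finite (\<tau> -` {i \<in> I. x i \<noteq> \<one>\<^bsub>A i\<^esub>} \<inter> J)"
      by (rule finite_vimage_IntI[OF _ \<tau>(1)]) (use x in \<open>simp add: carrier_D\<close>)
    ultimately have "finite {j \<in> J. x (\<tau> j) \<noteq> \<one>\<^bsub>A (\<tau> j)\<^esub>}"
      by (rule finite_subset)
    moreover have "{j \<in> I. ?s x j \<noteq> \<one>\<^bsub>A j\<^esub>} \<subseteq> {j \<in> J. x (\<tau> j) \<noteq> \<one>\<^bsub>A (\<tau> j)\<^esub>}"
      using g_one by (auto split: if_splits)
    ultimately have "finite {j \<in> I. ?s x j \<noteq> \<one>\<^bsub>A j\<^esub>}"
      by (rule finite_subset[rotated])
    moreover have "?s x j \<in> carrier (A j)" if "j \<in> I" for j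
      using that one_closed hom_in_carrier[OF g component_closed[OF x \<tau>I]] by simp
    ultimately show ?thesis
      unfolding carrier_D by (intro CollectI conjI PiE_I) (simp_all del: restrict_apply add: restrict_def)
  qed
  show "?s (x \<otimes>\<^bsub>D\<^esub> y) = ?s x \<otimes>\<^bsub>D\<^esub> ?s y" if xy: "x \<in> carrier D" "y \<in> carrier D" for x y
    using \<tau>I one_closed xy by (auto simp: l_one hom_mult[OF g] component_closed)
qed

text \<open>
  Chains avoiding any given finite set of indices exist, so there are pairwise disjoint
  chains of all lengths.
\<close>

lemma has_chain_avoiding:
  assumes "has_chain (n + card F)" "finite F"
  shows "\<exists>js. distinct js \<and> set js \<subseteq> I - F \<and> length js = n \<and> sorted_wrt weakly_below js"
proof -
  obtain js where js: "distinct js" "set js \<subseteq> I" "length js = n + card F" "sorted_wrt weakly_below js"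
    using assms(1) unfolding has_chain_iff by blast
  define ks where "ks = filter (\<lambda>i. i \<notin> F) js"
  have ks: "distinct ks" "set ks = set js - F" "sorted_wrt weakly_below ks"
    using js by (auto simp: ks_def sorted_wrt_filter)
  have "n + card F \<le> card (set ks) + card F"
    using js(3) distinct_card[OF js(1)] card_Un_le[of "set ks" F] card_mono[of "set ks \<union> F" "set js"]
      assms(2) ks(2) by auto
  then have "n \<le> length ks"
    using distinct_card[OF ks(1)] by simp
  then show ?thesis
    using ks js(2) set_take_subset[of n ks]
    by (intro exI[of _ "take n ks"]) (auto simp: sorted_wrt_take)
qed

lemma disjoint_chains:
  assumes "\<And>n. has_chain n"
  obtains L where "\<And>n. distinct (L n)" "\<And>n. set (L n) \<subseteq> I" "\<And>n. length (L n) = Suc n"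
    "\<And>n. sorted_wrt weakly_below (L n)" "\<And>m n. m \<noteq> n \<Longrightarrow> set (L m) \<inter> set (L n) = {}"
proof -
  define P where "P L n js \<longleftrightarrow> distinct js \<and> set js \<subseteq> I - (\<Union>m<n. set (L m)) \<and>
      length js = Suc n \<and> sorted_wrt weakly_below js" for L :: "nat \<Rightarrow> 'i list" and n js
  have "\<exists>L. \<forall>n. P L n (L n)"
  proof (rule dependent_wf_choice[OF wf_less_than])
    show "P L n js = P L' n js" if "\<And>m. (m, n) \<in> less_than \<Longrightarrow> L m = L' m" for L L' n js
      using that by (simp add: P_def)
    show "\<exists>js. P L n js" for L n
      unfolding P_def using assms by (intro has_chain_avoiding) auto
  qed
  then obtain L where L: "\<And>n. P L n (L n)" by blast
  have disj: "set (L m) \<inter> set (L n) = {}" if "m < n" for m n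
    using L[of n] that unfolding P_def by blast
  show thesis
  proof (rule that[of L])
    show "set (L m) \<inter> set (L n) = {}" if "m \<noteq> n" for m n
      using that disj[of m n] disj[of n m] by (metis Int_commute linorder_neqE_nat)
  qed (use L in \<open>auto simp: P_def\<close>)
qed

text \<open>
  Given disjoint chains \<open>a n 0, \<dots>, a n n\<close> for all \<open>n\<close>, shift each of them one step upwards. An
  element of infinite order in the first group of the \<open>n\<close>-th chain survives exactly \<open>n\<close> steps:
  by rank one its images stay of infinite order until it leaves the top of the chain.
\<close>

lemma not_SH_if_unbounded_chains:
  assumes "\<And>n. has_chain n"
  shows "\<not> strongly_Hopfian D"
proof -
  obtain L where L: "\<And>n. distinct (L n)" "\<And>n. set (L n) \<subseteq> I" "\<And>n. length (L n) = Suc n"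
    "\<And>n. sorted_wrt weakly_below (L n)" "\<And>m n. m \<noteq> n \<Longrightarrow> set (L m) \<inter> set (L n) = {}"
    using disjoint_chains[OF assms] by blast
  define a where "a n k = L n ! k" for n k
  have aL: "a n k \<in> set (L n)" if "k \<le> n" for n k
    using that L(3) unfolding a_def by simp
  have aI: "a n k \<in> I" if "k \<le> n" for n k
    using aL[OF that] L(2) by blast
  have a_inj: "m = n \<and> k = l" if "k \<le> m" "l \<le> n" "a m k = a n l" for m n k l
  proof -
    have "m = n"
      using aL[OF that(1)] aL[OF that(2)] that(3) L(5)[of m n] by auto
    moreover have "k = l"
      using that \<open>m = n\<close> nth_eq_iff_index_eq[OF L(1), of k n l] L(3) by (simp add: a_def)
    ultimately show ?thesis by blast
  qed
  define J where "J = {a n (Suc k) |n k. k < n}"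
  have "\<exists>i g. (\<exists>n k. k < n \<and> j = a n (Suc k) \<and> i = a n k) \<and> g \<in> hom (A i) (A j) \<and>
      \<not> g ` carrier (A i) \<subseteq> torsion_set (A j)" if j: "j \<in> J" for j
  proof -
    obtain n k where nk: "k < n" "j = a n (Suc k)"
      using j by (auto simp: J_def)
    have "weakly_below (a n k) (a n (Suc k))"
      using L(3,4) nk(1) by (simp add: a_def sorted_wrt_iff_nth_less)
    then obtain g where "g \<in> hom (A (a n k)) (A j)" "\<not> g ` carrier (A (a n k)) \<subseteq> torsion_set (A j)"
      unfolding weakly_below_def precsim_def nk(2) by blast
    with nk show ?thesis by blast
  qed
  then obtain \<tau> g where *: "\<And>j. j \<in> J \<Longrightarrow> \<exists>n k. k < n \<and> j = a n (Suc k) \<and> \<tau> j = a n k"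
    and g: "\<And>j. j \<in> J \<Longrightarrow> g j \<in> hom (A (\<tau> j)) (A j)"
    and g_tors: "\<And>j. j \<in> J \<Longrightarrow> \<not> g j ` carrier (A (\<tau> j)) \<subseteq> torsion_set (A j)"
    by metis
  have \<tau>: "\<tau> (a n (Suc k)) = a n k" if "k < n" for n k
  proof -
    have "a n (Suc k) \<in> J" using that by (auto simp: J_def)
    from *[OF this] obtain n' k' where "k' < n'" "a n (Suc k) = a n' (Suc k')" "\<tau> (a n (Suc k)) = a n' k'"
      by blast
    then show ?thesis using a_inj[of "Suc k" n "Suc k'" n'] that by auto
  qed
  have JI: "J \<subseteq> I" using aI by (auto simp: J_def)
  have "\<tau> ` J \<subseteq> I"
    using aI \<tau> by (auto simp: J_def)
  moreover have "inj_on \<tau> J"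
  proof (rule inj_onI)
    fix i j assume ij: "i \<in> J" "j \<in> J" "\<tau> i = \<tau> j"
    obtain m k where m: "k < m" "i = a m (Suc k)" using ij(1) by (auto simp: J_def)
    obtain n l where n: "l < n" "j = a n (Suc l)" using ij(2) by (auto simp: J_def)
    have "m = n \<and> k = l"
      using m n ij(3) \<tau> a_inj[of k m l n] by simp
    then show "i = j" using m n by simp
  qed
  define \<phi> where "\<phi> = (\<lambda>x. \<lambda>j\<in>I. if j \<in> J then g j (x (\<tau> j)) else \<one>\<^bsub>A j\<^esub>)"
  have \<phi>: "\<phi> \<in> hom D D"
    unfolding \<phi>_def by (rule partial_shift_hom[OF JI \<open>inj_on \<tau> J\<close> \<open>\<tau> ` J \<subseteq> I\<close> g])
  have g_one: "g j \<one>\<^bsub>A (\<tau> j)\<^esub> = \<one>\<^bsub>A j\<^esub>" if "j \<in> J" for j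
    using hom_one[OF g[OF that] grp grp] \<open>\<tau> ` J \<subseteq> I\<close> JI that by blast
  \<comment> \<open>An element supported at \<open>a n k\<close> is moved to \<open>a n (Suc k)\<close>, or to the identity if \<open>k = n\<close>.\<close>
  have off: "\<phi> x j = \<one>\<^bsub>A j\<^esub>"
    if "k \<le> n" "\<And>i. i \<in> I \<Longrightarrow> i \<noteq> a n k \<Longrightarrow> x i = \<one>\<^bsub>A i\<^esub>" "j \<in> I" "k < n \<Longrightarrow> j \<noteq> a n (Suc k)"
    for x n k j
  proof (cases "j \<in> J")
    case True
    then obtain n' k' where nk': "k' < n'" "j = a n' (Suc k')" by (auto simp: J_def)
    have "a n' k' \<noteq> a n k"
      using a_inj[of k' n' k n] nk' that(1,4) by auto
    then have "x (\<tau> j) = \<one>\<^bsub>A (\<tau> j)\<^esub>"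
      using that(2) aI nk' \<tau> by simp
    then show ?thesis using True that(3) g_one by (simp add: \<phi>_def)
  qed (simp add: \<phi>_def that(3))
  have "\<not> SH_exponent D \<phi> n" for n
  proof -
    obtain b where b: "b \<in> carrier (A (a n 0))" "b \<notin> torsion_set (A (a n 0))"
      using rank_one_nontorsion[OF comm rank] aI[of 0 n] by blast
    define x where "x = embed (a n 0) b"
    have x: "x \<in> carrier D"
      unfolding x_def using b(1) aI[of 0 n] by (simp add: embed_closed)
    have xk: "(\<phi> ^^ k) x \<in> carrier D" for k
      using hom_in_carrier[OF D.hom_funpow[OF \<phi>] x] .
    have main: "(\<phi> ^^ k) x (a n k) \<notin> torsion_set (A (a n k)) \<and>
        (\<forall>i\<in>I. i \<noteq> a n k \<longrightarrow> (\<phi> ^^ k) x i = \<one>\<^bsub>A i\<^esub>)" if "k \<le> n" for k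
      using that
    proof (induction k)
      case 0
      then show ?case using b aI[of 0 n] by (simp add: x_def embed_def)
    next
      case (Suc k)
      define y where "y = (\<phi> ^^ k) x"
      have k: "k < n" using Suc.prems by simp
      have y: "y (a n k) \<notin> torsion_set (A (a n k))"
        "\<And>i. i \<in> I \<Longrightarrow> i \<noteq> a n k \<Longrightarrow> y i = \<one>\<^bsub>A i\<^esub>" "y \<in> carrier D"
        using Suc.IH k xk by (auto simp: y_def)
      have J: "a n (Suc k) \<in> J" using k by (auto simp: J_def)
      obtain c where c: "c \<in> carrier (A (a n k))"
        "g (a n (Suc k)) c \<notin> torsion_set (A (a n (Suc k)))"
        using g_tors[OF J] \<tau>[OF k] by auto
      have I: "a n k \<in> I" "a n (Suc k) \<in> I" using aI k by simp_all
      have "g (a n (Suc k)) \<in> hom (A (a n k)) (A (a n (Suc k)))"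
        using g[OF J] \<tau>[OF k] by simp
      from rank_one_hom[OF comm[OF I(1)] rank[OF I(1)] comm[OF I(2)] this c
          component_closed[OF y(3) I(1)] y(1)]
      have "g (a n (Suc k)) (y (a n k)) \<notin> torsion_set (A (a n (Suc k)))" .
      then have "\<phi> y (a n (Suc k)) \<notin> torsion_set (A (a n (Suc k)))"
        using I J \<tau>[OF k] by (simp add: \<phi>_def)
      moreover have "\<phi> y i = \<one>\<^bsub>A i\<^esub>" if "i \<in> I" "i \<noteq> a n (Suc k)" for i
        using off[of k n y i] k y(2) that by simp
      ultimately show ?case by (simp add: y_def)
    qed
    have n: "a n n \<in> I" using aI by simp
    interpret An: comm_group "A (a n n)" by (rule comm[OF n])
    have "(\<phi> ^^ n) x \<noteq> \<one>\<^bsub>D\<^esub>"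
      using main[of n] n subgroup.one_closed[OF An.subgroup_torsion_set] by auto
    moreover have "(\<phi> ^^ Suc n) x = \<one>\<^bsub>D\<^esub>"
    proof (rule D_eqI[OF xk D.one_closed])
      show "(\<phi> ^^ Suc n) x j = \<one>\<^bsub>D\<^esub> j" if "j \<in> I" for j
        using off[of n n "(\<phi> ^^ n) x" j] main[of n] that by simp
    qed
    ultimately show ?thesis
      unfolding D.SH_exponent_iff[OF \<phi>] using x by blast
  qed
  then show ?thesis
    unfolding strongly_Hopfian_def using \<phi> by blast
qed

end

section \<open>Projections and complements\<close>

context comm_group
begin

text \<open>The projection onto the second factor of an internal direct product.\<close>

lemma direct_projection:
  assumes M: "subgroup M G" and C: "subgroup C G" and MC: "M \<inter> C = {\<one>}"
    and sum: "M <#> C = carrier G"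
  obtains \<pi> where "\<pi> \<in> hom G G" "\<And>x. x \<in> carrier G \<Longrightarrow> \<pi> x \<in> C"
    "\<And>m c. m \<in> M \<Longrightarrow> c \<in> C \<Longrightarrow> \<pi> (m \<otimes> c) = c"
proof -
  have uniq: "c = c'" if "m \<in> M" "m' \<in> M" "c \<in> C" "c' \<in> C" "m \<otimes> c = m' \<otimes> c'" for m m' c c'
  proof -
    have car: "m \<in> carrier G" "m' \<in> carrier G" "c \<in> carrier G" "c' \<in> carrier G"
      using that subgroup.mem_carrier[OF M] subgroup.mem_carrier[OF C] by auto
    have "inv m' \<otimes> m = inv m' \<otimes> (m \<otimes> c) \<otimes> inv c"
      using car by (simp add: m_assoc)
    also have "\<dots> = c' \<otimes> inv c"
      using car by (simp add: that(5) m_assoc[symmetric])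
    finally have eq: "inv m' \<otimes> m = c' \<otimes> inv c" .
    have "inv m' \<otimes> m \<in> M"
      by (intro subgroup.m_closed[OF M] subgroup.m_inv_closed[OF M] that)
    moreover have "c' \<otimes> inv c \<in> C"
      by (intro subgroup.m_closed[OF C] subgroup.m_inv_closed[OF C] that)
    ultimately have "c' \<otimes> inv c = \<one>"
      using eq MC by auto
    then show "c = c'"
      using car inv_equality[of c' "inv c"] by simp
  qed
  define \<pi> where "\<pi> x = (SOME c. c \<in> C \<and> (\<exists>m\<in>M. x = m \<otimes> c))" for x
  have \<pi>: "\<pi> x \<in> C \<and> (\<exists>m\<in>M. x = m \<otimes> \<pi> x)" if "x \<in> carrier G" for x
  proof -
    have "\<exists>c. c \<in> C \<and> (\<exists>m\<in>M. x = m \<otimes> c)"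
      using that unfolding sum[symmetric] set_mult_def by blast
    then show ?thesis unfolding \<pi>_def by (rule someI_ex)
  qed
  have \<pi>_eq: "\<pi> (m \<otimes> c) = c" if "m \<in> M" "c \<in> C" for m c
  proof -
    have "m \<otimes> c \<in> carrier G"
      using that subgroup.mem_carrier[OF M] subgroup.mem_carrier[OF C] by simp
    from \<pi>[OF this] obtain m' where "m' \<in> M" "m \<otimes> c = m' \<otimes> \<pi> (m \<otimes> c)" "\<pi> (m \<otimes> c) \<in> C"
      by blast
    then show ?thesis using uniq that by metis
  qed
  show thesis
  proof (rule that)
    show "\<pi> \<in> hom G G"
    proof (rule homI)
      show "\<pi> x \<in> carrier G" if "x \<in> carrier G" for x
        using \<pi>[OF that] subgroup.mem_carrier[OF C] by blast
      fix x y assume x: "x \<in> carrier G" and y: "y \<in> carrier G"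
      obtain m n where mn: "m \<in> M" "x = m \<otimes> \<pi> x" "n \<in> M" "y = n \<otimes> \<pi> y"
        using \<pi>[OF x] \<pi>[OF y] by blast
      have car: "m \<in> carrier G" "n \<in> carrier G" "\<pi> x \<in> carrier G" "\<pi> y \<in> carrier G"
        using mn \<pi>[OF x] \<pi>[OF y] subgroup.mem_carrier[OF M] subgroup.mem_carrier[OF C] by auto
      have "x \<otimes> y = (m \<otimes> \<pi> x) \<otimes> (n \<otimes> \<pi> y)"
        using mn by simp
      also have "\<dots> = (m \<otimes> n) \<otimes> (\<pi> x \<otimes> \<pi> y)"
        using car by (simp add: m_ac)
      finally have "\<pi> (x \<otimes> y) = \<pi> ((m \<otimes> n) \<otimes> (\<pi> x \<otimes> \<pi> y))"
        by simp
      also have "\<dots> = \<pi> x \<otimes> \<pi> y"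
        using mn \<pi>[OF x] \<pi>[OF y] by (intro \<pi>_eq subgroup.m_closed[OF M] subgroup.m_closed[OF C]) auto
      finally show "\<pi> (x \<otimes> y) = \<pi> x \<otimes> \<pi> y" .
    qed
  qed (use \<pi> \<pi>_eq in auto)
qed

lemma subgroup_coprime_pow:
  assumes S: "subgroup S G" and x: "x \<in> carrier G"
    and "x [^] (a::int) \<in> S" "x [^] (b::int) \<in> S" "coprime a b"
  shows "x \<in> S"
proof -
  obtain u v where uv: "u * a + v * b = 1"
    using bezout_int[of a b] assms(5) by auto
  have "(x [^] a) [^] u \<otimes> (x [^] b) [^] v \<in> S"
    by (intro subgroup.m_closed[OF S] subgroup_int_pow_closed[OF S] assms)
  also have "(x [^] a) [^] u \<otimes> (x [^] b) [^] v = x [^] (a * u + b * v)"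
    using x by (simp only: int_pow_pow int_pow_mult)
  also have "a * u + b * v = 1"
    using uv by (simp add: mult.commute)
  finally show ?thesis using x by simp
qed

text \<open>The \<open>n\<close>-th powers, written \<open>nG\<close> in additive notation.\<close>

definition powers :: "nat \<Rightarrow> 'a set" where
  "powers n = (\<lambda>x. x [^] n) ` carrier G"

lemma power_hom: "(\<lambda>x. x [^] (n::nat)) \<in> hom G G"
  by (rule homI) (simp_all add: nat_pow_distrib)

lemma subgroup_powers: "subgroup (powers n) G"
proof -
  interpret h: group_hom G G "\<lambda>x. x [^] n"
    using power_hom by (simp add: group_hom_def group_hom_axioms_def)
  show ?thesis unfolding powers_def by (rule h.img_is_subgroup)
qed

lemma subgroup_cyclic:
  assumes "x \<in> carrier G"
  shows "subgroup (range (\<lambda>i::int. x [^] i)) G"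
proof (rule subgroupI)
  show "inv a \<in> range (\<lambda>i::int. x [^] i)" if a: "a \<in> range (\<lambda>i::int. x [^] i)" for a
  proof -
    obtain i :: int where "a = x [^] i" using a by blast
    then have "inv a = x [^] (- i)" using assms by (simp add: int_pow_neg)
    then show ?thesis by blast
  qed
  show "a \<otimes> b \<in> range (\<lambda>i::int. x [^] i)"
    if ab: "a \<in> range (\<lambda>i::int. x [^] i)" "b \<in> range (\<lambda>i::int. x [^] i)" for a b
  proof -
    obtain i j :: int where "a = x [^] i" "b = x [^] j" using ab by blast
    then have "a \<otimes> b = x [^] (i + j)" using assms by (simp add: int_pow_mult)
    then show ?thesis by blast
  qed
qed (use assms in auto)

lemma subgroup_Union_chain:
  assumes "\<C> \<noteq> {}" "\<And>S. S \<in> \<C> \<Longrightarrow> subgroup S G" "\<And>S T. S \<in> \<C> \<Longrightarrow> T \<in> \<C> \<Longrightarrow> S \<subseteq> T \<or> T \<subseteq> S"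
  shows "subgroup (\<Union>\<C>) G"
proof (rule subgroupI)
  show "\<Union>\<C> \<subseteq> carrier G"
    by (rule Union_least) (rule subgroup.subset[OF assms(2)])
  from assms(1) obtain S where "S \<in> \<C>" by blast
  then show "\<Union>\<C> \<noteq> {}"
    using subgroup.one_closed[OF assms(2)] by blast
  show "inv a \<in> \<Union>\<C>" if "a \<in> \<Union>\<C>" for a
    using that by (auto intro: subgroup.m_inv_closed[OF assms(2)])
  show "a \<otimes> b \<in> \<Union>\<C>" if ab: "a \<in> \<Union>\<C>" "b \<in> \<Union>\<C>" for a b
  proof -
    obtain S T where ST: "S \<in> \<C>" "T \<in> \<C>" "a \<in> S" "b \<in> T"
      using ab by blast
    then obtain R where "R \<in> \<C>" "a \<in> R" "b \<in> R"
      using assms(3)[of S T] by blast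
    then have "a \<otimes> b \<in> R"
      by (intro subgroup.m_closed[OF assms(2)])
    with \<open>R \<in> \<C>\<close> show ?thesis by (rule UnionI)
  qed
qed

lemma subset_set_mult:
  assumes "subgroup M G" "subgroup C G"
  shows "M \<subseteq> M <#> C" "C \<subseteq> M <#> C"
proof
  fix x assume "x \<in> M"
  then have "x = x \<otimes> \<one>" using subgroup.mem_carrier[OF assms(1)] by simp
  then show "x \<in> M <#> C"
    using \<open>x \<in> M\<close> subgroup.one_closed[OF assms(2)] unfolding set_mult_def by blast
next
  show "C \<subseteq> M <#> C"
  proof
    fix x assume "x \<in> C"
    then have "x = \<one> \<otimes> x" using subgroup.mem_carrier[OF assms(2)] by simp
    then show "x \<in> M <#> C"
      using \<open>x \<in> C\<close> subgroup.one_closed[OF assms(1)] unfolding set_mult_def by blast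
  qed
qed

text \<open>
  Let \<open>C\<close> meet the \<open>p ^ Suc j\<close>-th powers trivially, so that \<open>p ^ Suc j\<close> annihilates \<open>C\<close>, and
  let every element of \<open>C\<close> annihilated by \<open>p ^ j\<close> be a \<open>p\<close>-th power in \<open>C\<close>, as in a direct sum
  of cyclic groups of order \<open>p ^ Suc j\<close>. Then \<open>C\<close> is a direct summand: any subgroup that is
  maximal among those containing the \<open>p ^ Suc j\<close>-th powers and meeting \<open>C\<close> trivially is a
  complement.
\<close>

lemma complement_exists:
  assumes p: "prime (p::nat)" and C: "subgroup C G"
    and C_tors: "\<And>c. c \<in> C \<Longrightarrow> c [^] (p ^ j) = \<one> \<Longrightarrow> \<exists>d\<in>C. d [^] p = c"
    and C_powers: "C \<inter> powers (p ^ Suc j) = {\<one>}"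
  obtains M where "subgroup M G" "M \<inter> C = {\<one>}" "M <#> C = carrier G"
proof -
  define q where "q = p ^ Suc j"
  define \<A> where "\<A> = {M. subgroup M G \<and> powers q \<subseteq> M \<and> M \<inter> C = {\<one>}}"
  have "\<exists>M\<in>\<A>. \<forall>X\<in>\<A>. M \<subseteq> X \<longrightarrow> X = M"
  proof (rule subset_Zorn_nonempty)
    have "powers q \<in> \<A>"
      using subgroup_powers C_powers by (auto simp: \<A>_def q_def)
    then show "\<A> \<noteq> {}" by blast
    fix \<C> assume ne: "\<C> \<noteq> {}" and ch: "subset.chain \<A> \<C>"
    have sub: "\<C> \<subseteq> \<A>" using ch by (auto simp: subset_chain_def)
    have tot: "S \<subseteq> T \<or> T \<subseteq> S" if "S \<in> \<C>" "T \<in> \<C>" for S T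
      using ch that by (auto simp: subset_chain_def)
    have "subgroup (\<Union>\<C>) G"
      by (rule subgroup_Union_chain[OF ne _ tot]) (use sub in \<open>auto simp: \<A>_def\<close>)
    moreover have "powers q \<subseteq> \<Union>\<C>" "\<Union>\<C> \<inter> C = {\<one>}"
      using ne sub by (fastforce simp: \<A>_def)+
    ultimately show "\<Union>\<C> \<in> \<A>" by (simp add: \<A>_def)
  qed
  then obtain M where MA: "M \<in> \<A>" and max: "\<forall>X\<in>\<A>. M \<subseteq> X \<longrightarrow> X = M"
    by (elim bexE)
  from MA have M: "subgroup M G" "powers q \<subseteq> M" "M \<inter> C = {\<one>}"
    by (simp_all add: \<A>_def)
  define S where "S = M <#> C"
  have S: "subgroup S G" "M \<subseteq> S" "C \<subseteq> S"
    unfolding S_def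
    by (rule mult_subgroups[OF M(1) C] subset_set_mult[OF M(1) C])+
  have "carrier G \<subseteq> S"
  proof (rule ccontr)
    assume "\<not> carrier G \<subseteq> S"
    then obtain x where x: "x \<in> carrier G" "x \<notin> S" by blast
    have "x [^] q \<in> S"
      using M(2) S(2) x(1) by (auto simp: powers_def)
    then have ex: "\<exists>r. x [^] (p ^ r) \<in> S"
      unfolding q_def by blast
    define r where "r = (LEAST r. x [^] (p ^ r) \<in> S)"
    have r: "x [^] (p ^ r) \<in> S"
      unfolding r_def using ex by (rule LeastI_ex)
    have "r \<noteq> 0"
      using r x by (cases r) auto
    then obtain r' where r': "r = Suc r'" using not0_implies_Suc by blast
    \<comment> \<open>Replace \<open>x\<close> by an element \<open>z\<close> outside \<open>S\<close> with \<open>z [^] p\<close> in \<open>S\<close>.\<close>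
    define z where "z = x [^] (p ^ r')"
    have z: "z \<in> carrier G" "z \<notin> S"
      using x not_less_Least[of r' "\<lambda>r. x [^] (p ^ r) \<in> S"] r'
      unfolding z_def r_def[symmetric] by auto
    have "z [^] p \<in> S"
      using r x(1) unfolding z_def r' by (simp add: nat_pow_pow mult.commute)
    then obtain m c where mc: "m \<in> M" "c \<in> C" "z [^] p = m \<otimes> c"
      unfolding S_def set_mult_def by blast
    have car: "m \<in> carrier G" "c \<in> carrier G"
      using mc subgroup.mem_carrier[OF M(1)] subgroup.mem_carrier[OF C] by auto
    have "z [^] q = (z [^] p) [^] (p ^ j)"
      using z(1) by (simp add: q_def nat_pow_pow)
    also have "\<dots> = c [^] (p ^ j) \<otimes> m [^] (p ^ j)"
      using car by (simp add: mc(3) nat_pow_distrib m_comm)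
    finally have "c [^] (p ^ j) \<otimes> m [^] (p ^ j) \<in> M"
      using M(2) z(1) by (auto simp: powers_def)
    moreover have "m [^] (p ^ j) \<in> M"
      using subgroup_int_pow_closed[OF M(1) mc(1), of "int (p ^ j)"] by (simp only: int_pow_int)
    ultimately have "c [^] (p ^ j) \<in> M"
      using subgroup_mult_cancel[OF M(1) nat_pow_closed[OF car(2)]] by blast
    moreover have "c [^] (p ^ j) \<in> C"
      using subgroup_int_pow_closed[OF C mc(2), of "int (p ^ j)"] by (simp only: int_pow_int)
    ultimately obtain d where d: "d \<in> C" "d [^] p = c"
      using C_tors[OF mc(2)] M(3) by blast
    have dc: "d \<in> carrier G" using d(1) subgroup.mem_carrier[OF C] by blast
    \<comment> \<open>Correcting \<open>z\<close> by \<open>d\<close> moves its \<open>p\<close>-th power from \<open>S\<close> into \<open>M\<close>, so \<open>M\<close> can be enlarged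
      by \<open>w\<close> without meeting \<open>C\<close>, against maximality.\<close>
    define w where "w = z \<otimes> inv d"
    have w: "w \<in> carrier G" using z dc by (simp add: w_def)
    have "w \<notin> S"
    proof
      assume "w \<in> S"
      moreover have "inv d \<in> S"
        using S(3) subgroup.m_inv_closed[OF C d(1)] by blast
      ultimately show False
        using subgroup_mult_cancel[OF S(1) z(1), of "inv d"] z(2) by (simp add: w_def)
    qed
    have "w [^] p = z [^] p \<otimes> inv (d [^] p)"
      using z dc by (simp add: w_def nat_pow_distrib nat_pow_inv)
    then have wp: "w [^] p \<in> M"
      using car d(2) mc by (simp add: m_assoc)
    define W where "W = range (\<lambda>i::int. w [^] i)"
    have W: "subgroup W G" unfolding W_def by (rule subgroup_cyclic[OF w])
    have "w \<in> W" unfolding W_def by (rule range_eqI[of _ _ 1]) (simp add: w)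
    define X where "X = M <#> W"
    have X: "subgroup X G" "M \<subseteq> X" "W \<subseteq> X"
      unfolding X_def
      by (rule mult_subgroups[OF M(1) W] subset_set_mult[OF M(1) W])+
    have "X \<noteq> M" using X(3) \<open>w \<in> W\<close> \<open>w \<notin> S\<close> S(2) by blast
    then have "X \<notin> \<A>" using max X(2) by blast
    then have "X \<inter> C \<noteq> {\<one>}" using X M(2) by (auto simp: \<A>_def)
    moreover have "\<one> \<in> X \<inter> C" using subgroup.one_closed[OF X(1)] subgroup.one_closed[OF C] by simp
    ultimately obtain c' where c': "c' \<in> X" "c' \<in> C" "c' \<noteq> \<one>" by blast
    then obtain m' and a :: int where a: "m' \<in> M" "c' = m' \<otimes> w [^] a"
      unfolding X_def W_def set_mult_def by blast
    have m'c: "m' \<in> carrier G" using a(1) subgroup.mem_carrier[OF M(1)] by blast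
    show False
    proof (cases "int p dvd a")
      case True
      then obtain b where b: "a = int p * b" by blast
      have "w [^] a = (w [^] p) [^] b"
        unfolding b using w int_pow_pow[of w "int p" b] by (simp only: int_pow_int)
      then have "w [^] a \<in> M"
        using subgroup_int_pow_closed[OF M(1) wp] by simp
      then have "c' \<in> M"
        using a subgroup.m_closed[OF M(1)] by simp
      then show False using c' M(3) by blast
    next
      case False
      have "w [^] a \<otimes> m' \<in> S"
        using a(2) c'(2) S(3) w m'c by (auto simp: m_comm)
      then have "w [^] a \<in> S"
        using subgroup_mult_cancel[OF S(1) int_pow_closed[OF w]] a(1) S(2) by blast
      moreover have "w [^] int p \<in> S"
        using wp S(2) by (auto simp: int_pow_int)
      moreover have "coprime a (int p)"
        using False p by (metis coprime_commute prime_imp_coprime prime_nat_int_transfer)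
      ultimately have "w \<in> S"
        using subgroup_coprime_pow[OF S(1) w] by blast
      with \<open>w \<notin> S\<close> show False ..
    qed
  qed
  then have "S = carrier G" using subgroup.subset[OF S(1)] by simp
  with M that show thesis unfolding S_def by blast
qed

section \<open>Finiteness of the primary components\<close>

lemma subgroup_roots: "subgroup {x \<in> carrier G. x [^] (n::nat) = \<one>} G"
proof (rule subgroupI)
  show "{x \<in> carrier G. x [^] n = \<one>} \<noteq> {}"
    using one_closed nat_pow_one by blast
qed (auto simp: nat_pow_inv nat_pow_distrib)

lemma hom_free_Abelian_group:
  assumes "h \<in> hom (free_Abelian_group UNIV) G"
  shows "h a \<in> carrier G" "h 0 = \<one>" "h (a + b) = h a \<otimes> h b" "h (a - b) = h a \<otimes> inv (h b)"
    "h (frag_cmul n a) = h a [^] n"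
proof -
  interpret h: group_hom "free_Abelian_group UNIV" G h
    using assms by (simp add: group_hom_def group_hom_axioms_def)
  show car: "h a \<in> carrier G" for a using h.hom_closed[of a] by simp
  show "h 0 = \<one>" using h.hom_one by simp
  show add: "h (a + b) = h a \<otimes> h b" for a b using h.hom_mult[of a b] by simp
  have "h (- b) = inv (h b)" using h.hom_inv[of b] by simp
  then show "h (a - b) = h a \<otimes> inv (h b)" using add[of a "- b"] by simp
  show "h (frag_cmul n a) = h a [^] n" using h.hom_int_pow[of a n] by simp
qed

lemma hom_free_Abelian_group_mem:
  assumes "h \<in> hom (free_Abelian_group UNIV) G" "subgroup S G"
    and "\<And>i. i \<in> Poly_Mapping.keys a \<Longrightarrow> h (frag_of i) \<in> S"
  shows "h a \<in> S"
proof (rule frag_induction[OF order_refl[of "Poly_Mapping.keys a"], where P = "\<lambda>a. h a \<in> S"])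
  show "h 0 \<in> S"
    using hom_free_Abelian_group(2)[OF assms(1)] subgroup.one_closed[OF assms(2)] by simp
  show "h (a - b) \<in> S" if "h a \<in> S" "h b \<in> S" for a b
    unfolding hom_free_Abelian_group(4)[OF assms(1)]
    by (intro subgroup.m_closed[OF assms(2)] subgroup.m_inv_closed[OF assms(2)] that)
qed (rule assms(3))

lemma frag_divisible:
  fixes a :: "'k \<Rightarrow>\<^sub>0 int"
  assumes "\<And>i. q dvd Poly_Mapping.lookup a i"
  obtains b where "a = frag_cmul q b"
proof
  show "a = frag_cmul q (Poly_Mapping.map (\<lambda>c. c div q) a)"
    by (rule poly_mapping_eqI) (use assms in \<open>simp add: Poly_Mapping.map.rep_eq when_def\<close>)
qed

text \<open>
  The hypotheses say that the elements \<open>h (frag_of n)\<close> generate a direct sum \<open>C\<close> of infinitely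
  many cyclic groups of order \<open>p ^ Suc j\<close> that meets the \<open>p ^ Suc j\<close>-th powers trivially. The
  left shift of these generators extends to an endomorphism by means of a complement of \<open>C\<close>, and
  its powers have strictly increasing kernels.
\<close>

lemma not_SH_if_infinite_homocyclic:
  assumes p: "prime (p::nat)" and h: "h \<in> hom (free_Abelian_group UNIV) G"
    and order: "\<And>i::nat. h (frag_of i) [^] (p ^ Suc j) = \<one>"
    and indep: "\<And>a i. h a \<in> powers (p ^ Suc j) \<Longrightarrow> int (p ^ Suc j) dvd Poly_Mapping.lookup a i"
  shows "\<not> strongly_Hopfian G"
proof -
  note h_simps = hom_free_Abelian_group[OF h]
  define q where "q = p ^ Suc j"
  have h_q: "h (frag_cmul (int q) a) = \<one>" for a
  proof -
    have "h a \<in> {x \<in> carrier G. x [^] q = \<one>}"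
      by (rule hom_free_Abelian_group_mem[OF h subgroup_roots]) (use order h_simps(1) in \<open>simp add: q_def\<close>)
    then show ?thesis by (simp add: h_simps(5) int_pow_int)
  qed
  define C where "C = range h"
  have C: "subgroup C G"
  proof -
    interpret h: group_hom "free_Abelian_group UNIV" G h
      using h by (simp add: group_hom_def group_hom_axioms_def)
    have "carrier (free_Abelian_group (UNIV :: nat set)) = UNIV" by auto
    then show ?thesis using h.img_is_subgroup unfolding C_def by simp
  qed
  have one_powers: "\<one> \<in> powers q"
    using subgroup.one_closed[OF subgroup_powers] .
  obtain M where M: "subgroup M G" "M \<inter> C = {\<one>}" "M <#> C = carrier G"
  proof (rule complement_exists[OF p C, of j])
    show "\<exists>d\<in>C. d [^] p = c" if c: "c \<in> C" "c [^] (p ^ j) = \<one>" for c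
    proof -
      obtain a where a: "c = h a" using c(1) by (auto simp: C_def)
      have "h (frag_cmul (int (p ^ j)) a) = \<one>"
        using c(2) unfolding h_simps(5) a int_pow_int .
      then have "int (p ^ Suc j) dvd int (p ^ j) * Poly_Mapping.lookup a i" for i
        using indep[of "frag_cmul (int (p ^ j)) a" i] one_powers by (simp add: q_def)
      then have "int p dvd Poly_Mapping.lookup a i" for i
        using p by (simp add: mult.commute prime_gt_0_nat)
      then obtain b where "a = frag_cmul (int p) b"
        using frag_divisible by metis
      then have "h b [^] p = c"
        by (simp add: a h_simps(5) int_pow_int)
      then show ?thesis unfolding C_def by blast
    qed
    show "C \<inter> powers (p ^ Suc j) = {\<one>}"
    proof -
      have "c = \<one>" if "c \<in> C" "c \<in> powers q" for c
      proof -
        from that(1) obtain a where a: "c = h a" by (auto simp: C_def)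
        have "int q dvd Poly_Mapping.lookup a i" for i
          using indep[of a i] that(2) by (simp add: a q_def)
        then obtain b where "a = frag_cmul (int q) b"
          using frag_divisible by metis
        then show ?thesis using h_q a by simp
      qed
      then show ?thesis
        using one_powers subgroup.one_closed[OF C] unfolding q_def by blast
    qed
  qed
  obtain \<pi> where \<pi>: "\<pi> \<in> hom G G" "\<And>x. x \<in> carrier G \<Longrightarrow> \<pi> x \<in> C"
    "\<And>m c. m \<in> M \<Longrightarrow> c \<in> C \<Longrightarrow> \<pi> (m \<otimes> c) = c"
    using direct_projection[OF M(1) C M(2,3)] by blast
  have \<pi>_C: "\<pi> c = c" if "c \<in> C" for c
    using \<pi>(3)[OF subgroup.one_closed[OF M(1)] that] subgroup.mem_carrier[OF C that] by simp
  define \<sigma> where "\<sigma> = frag_extend (\<lambda>n::nat. if n = 0 then 0 else frag_of (n - 1))"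
  have \<sigma>_kernel: "h (\<sigma> a) = h (\<sigma> b)" if "h a = h b" for a b
  proof -
    have "h (a - b) = \<one>" using that h_simps(1,4) by simp
    then have "int q dvd Poly_Mapping.lookup (a - b) i" for i
      using indep[of "a - b" i] one_powers by (simp add: q_def)
    then obtain d where "a - b = frag_cmul (int q) d"
      using frag_divisible by metis
    then have "\<sigma> a - \<sigma> b = frag_cmul (int q) (\<sigma> d)"
      unfolding \<sigma>_def by (metis frag_extend_cmul frag_extend_diff)
    then have "h (\<sigma> a) \<otimes> inv (h (\<sigma> b)) = \<one>"
      using h_simps(4) h_q by metis
    then show ?thesis
      using inv_equality[of "h (\<sigma> a)" "inv (h (\<sigma> b))"] h_simps(1) by simp
  qed
  define s where "s c = h (\<sigma> (SOME a. h a = c))" for c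
  have s: "s (h a) = h (\<sigma> a)" for a
    unfolding s_def by (rule \<sigma>_kernel) (rule someI[of "\<lambda>b. h b = h a"], simp)
  define \<phi> where "\<phi> = (\<lambda>x. s (\<pi> x))"
  have \<phi>_h: "\<phi> (h a) = h (\<sigma> a)" for a
    using \<pi>_C[of "h a"] s by (simp add: \<phi>_def C_def)
  have \<phi>: "\<phi> \<in> hom G G"
  proof (rule homI)
    fix x y assume x: "x \<in> carrier G" and y: "y \<in> carrier G"
    obtain a b where ab: "\<pi> x = h a" "\<pi> y = h b"
      using \<pi>(2)[OF x] \<pi>(2)[OF y] unfolding C_def by blast
    have "\<pi> (x \<otimes> y) = h (a + b)"
      using hom_mult[OF \<pi>(1) x y] ab h_simps(3) by simp
    then have "\<phi> (x \<otimes> y) = h (\<sigma> (a + b))"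
      by (simp only: \<phi>_def s)
    also have "\<sigma> (a + b) = \<sigma> a + \<sigma> b"
      by (simp only: \<sigma>_def frag_extend_add)
    finally show "\<phi> (x \<otimes> y) = \<phi> x \<otimes> \<phi> y"
      by (simp only: \<phi>_def ab s h_simps(3))
    show "\<phi> x \<in> carrier G"
      unfolding \<phi>_def ab s by (rule h_simps(1))
  qed
  have shift: "(\<phi> ^^ k) (h (frag_of (k + i))) = h (frag_of i)" for k i
  proof (induction k arbitrary: i)
    case (Suc k)
    have "(\<phi> ^^ k) (h (frag_of (Suc k + i))) = h (frag_of (Suc i))"
      using Suc.IH[of "Suc i"] by simp
    then show ?case by (simp add: \<phi>_h \<sigma>_def)
  qed simp
  have "h (frag_of 0) \<noteq> \<one>"
  proof
    assume "h (frag_of 0) = \<one>"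
    then have "int q dvd 1"
      using indep[of "frag_of 0" 0] one_powers by (simp add: q_def)
    moreover have "int p dvd int q" by (simp add: q_def)
    ultimately have "int p dvd 1" by (rule dvd_trans[rotated])
    then show False using p by auto
  qed
  moreover have "\<phi> (h (frag_of 0)) = \<one>"
    unfolding \<phi>_h \<sigma>_def frag_extend_of by (simp add: h_simps(2))
  ultimately have "\<not> SH_exponent G \<phi> n" for n
    using shift[of n 0] h_simps(1)[of "frag_of n"]
    unfolding SH_exponent_iff[OF \<phi>] funpow.simps comp_apply add_0_right by metis
  then show ?thesis
    unfolding strongly_Hopfian_def using \<phi> by blast
qed

text \<open>The elements annihilated by \<open>p\<close> that have \<open>p\<close>-height at least \<open>k\<close>.\<close>

definition socle :: "nat \<Rightarrow> nat \<Rightarrow> 'a set" where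
  "socle p k = {x \<in> powers (p ^ k). x [^] p = \<one>}"

lemma subgroup_socle: "subgroup (socle p k) G"
proof -
  have "socle p k = powers (p ^ k) \<inter> {x \<in> carrier G. x [^] p = \<one>}"
    using subgroup.mem_carrier[OF subgroup_powers] by (auto simp: socle_def)
  then show ?thesis using subgroups_Inter_pair[OF subgroup_powers subgroup_roots] by simp
qed

lemma finite_set_mult_cyclic:
  assumes "finite U" "x \<in> carrier G" "x [^] (p::nat) = \<one>" "p > 0"
  shows "finite (U <#> range (\<lambda>i::int. x [^] i))"
proof -
  have "x [^] i = x [^] (i mod int p)" for i :: int
  proof -
    have "x [^] i = x [^] (int p * (i div int p) + i mod int p)" by simp
    also have "\<dots> = (x [^] int p) [^] (i div int p) \<otimes> x [^] (i mod int p)"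
      using assms(2) by (simp only: int_pow_mult int_pow_pow)
    also have "\<dots> = x [^] (i mod int p)"
      using assms(2,3) by (simp add: int_pow_int)
    finally show ?thesis .
  qed
  moreover have "i mod int p \<in> {0..<int p}" for i
    using assms(4) by simp
  ultimately have "range (\<lambda>i::int. x [^] i) \<subseteq> (\<lambda>i. x [^] i) ` {0..<int p}"
    by blast
  then have "finite (range (\<lambda>i::int. x [^] i))"
    by (rule finite_subset) simp
  moreover have "U <#> W = (\<lambda>(u, w). u \<otimes> w) ` (U \<times> W)" for W
    by (auto simp: set_mult_def)
  ultimately show ?thesis
    using assms(1) by simp
qed

text \<open>
  A sequence in \<open>socle p j\<close> that is linearly independent over the field with \<open>p\<close> elements modulo
  \<open>socle p (Suc j)\<close>: the subgroup \<open>U n\<close> contains \<open>socle p (Suc j)\<close> and the first \<open>n\<close> members,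
  but not the next member \<open>x n\<close>.
\<close>

lemma independent_in_socle:
  assumes p: "prime (p::nat)" and fin: "finite (socle p (Suc j))" and inf: "infinite (socle p j)"
  obtains U and x :: "nat \<Rightarrow> 'a" where "\<And>n. subgroup (U n) G" "\<And>n. socle p (Suc j) \<subseteq> U n"
    "\<And>n. x n \<in> socle p j" "\<And>n. x n \<notin> U n" "\<And>n. U n \<subseteq> U (Suc n)" "\<And>n. x n \<in> U (Suc n)"
proof -
  define P where "P Ux \<longleftrightarrow> subgroup (fst Ux) G \<and> finite (fst Ux) \<and> socle p (Suc j) \<subseteq> fst Ux \<and>
    snd Ux \<in> socle p j \<and> snd Ux \<notin> fst Ux" for Ux :: "'a set \<times> 'a"
  define Q where "Q Ux Vy \<longleftrightarrow> fst Ux \<subseteq> fst Vy \<and> snd Ux \<in> fst Vy" for Ux Vy :: "'a set \<times> 'a"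
  have ext: "\<exists>y. P (V, y)" if "subgroup V G" "finite V" "socle p (Suc j) \<subseteq> V" for V
  proof -
    obtain y where "y \<in> socle p j" "y \<notin> V"
      by (meson inf \<open>finite V\<close> finite_subset subsetI)
    with that show ?thesis by (auto simp: P_def)
  qed
  have "\<exists>f. \<forall>n::nat. P (f n) \<and> Q (f n) (f (Suc n))"
  proof (rule dependent_nat_choice)
    show "\<exists>Ux. P Ux" using ext[OF subgroup_socle fin] by blast
    fix Ux :: "'a set \<times> 'a" assume Ux: "P Ux"
    obtain U x where Ux_eq: "Ux = (U, x)" by (cases Ux)
    have U: "subgroup U G" "finite U" "socle p (Suc j) \<subseteq> U" and x: "x \<in> socle p j"
      using Ux by (simp_all add: P_def Ux_eq)
    have xc: "x \<in> carrier G" using subgroup.mem_carrier[OF subgroup_socle x] .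
    have xp: "x [^] p = \<one>" using x by (simp add: socle_def)
    define W where "W = range (\<lambda>i::int. x [^] i)"
    have W: "subgroup W G" unfolding W_def by (rule subgroup_cyclic[OF xc])
    have "x \<in> W" unfolding W_def by (rule range_eqI[of _ _ 1]) (simp add: xc)
    define V where "V = U <#> W"
    have V: "subgroup V G" "U \<subseteq> V" "W \<subseteq> V"
      unfolding V_def by (rule mult_subgroups[OF U(1) W] subset_set_mult[OF U(1) W])+
    have "finite V"
      unfolding V_def W_def by (rule finite_set_mult_cyclic[OF U(2) xc xp]) (rule prime_gt_0_nat[OF p])
    then obtain y where "P (V, y)"
      using ext[OF V(1)] U(3) V(2) by blast
    moreover have "Q Ux (V, y)"
      using V(2,3) \<open>x \<in> W\<close> by (auto simp: Q_def Ux_eq)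
    ultimately show "\<exists>Vy. P Vy \<and> Q Ux Vy" by blast
  qed
  then obtain f where f: "\<And>n::nat. P (f n)" "\<And>n. Q (f n) (f (Suc n))" by blast
  show thesis
    by (rule that[of "\<lambda>n. fst (f n)" "\<lambda>n. snd (f n)"]) (use f in \<open>simp_all add: P_def Q_def\<close>)
qed

text \<open>
  If the elements \<open>x n\<close> of height \<open>j\<close> are independent modulo those of height \<open>Suc j\<close>, then
  \<open>p ^ j\<close>-th roots \<open>y n\<close> of them generate an infinite direct sum of cyclic groups of order
  \<open>p ^ Suc j\<close> to which the preceding lemma on shifts applies.
\<close>

lemma finite_socle_if_SH:
  assumes p: "prime (p::nat)" and SH: "strongly_Hopfian G" and fin: "finite (socle p (Suc j))"
  shows "finite (socle p j)"
proof (rule ccontr)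
  assume "infinite (socle p j)"
  then obtain U and x :: "nat \<Rightarrow> 'a" where U: "\<And>n. subgroup (U n) G" "\<And>n. socle p (Suc j) \<subseteq> U n"
    and x: "\<And>n. x n \<in> socle p j" "\<And>n. x n \<notin> U n"
    and step: "\<And>n. U n \<subseteq> U (Suc n)" "\<And>n. x n \<in> U (Suc n)"
    using independent_in_socle[OF p fin] by blast
  have x_U: "x m \<in> U n" if "m < n" for m n
  proof -
    have "U (Suc m) \<subseteq> U n"
      by (rule lift_Suc_mono_le[of U, OF step(1)]) (use that in simp)
    then show ?thesis using step(2) by blast
  qed
  have xc: "x n \<in> carrier G" for n
    using subgroup.mem_carrier[OF subgroup_socle x(1)] .
  have xp: "x n [^] p = \<one>" for n
    using x(1) by (simp add: socle_def)
  have "\<exists>y\<in>carrier G. y [^] (p ^ j) = x n" for n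
    using x(1)[of n] by (auto simp: socle_def powers_def)
  then obtain y where y: "\<And>n. y n \<in> carrier G" "\<And>n. y n [^] (p ^ j) = x n"
    by metis
  obtain h where h: "h \<in> hom (free_Abelian_group UNIV) G" "\<And>n::nat. h (frag_of n) = y n"
    by (rule free_Abelian_group_universal[of y UNIV]) (use y(1) in auto)
  obtain g where g: "g \<in> hom (free_Abelian_group UNIV) G" "\<And>n::nat. g (frag_of n) = x n"
    by (rule free_Abelian_group_universal[of x UNIV]) (use xc in auto)
  note h_simps = hom_free_Abelian_group[OF h(1)]
  note g_simps = hom_free_Abelian_group[OF g(1)]
  have g_eq: "g a = h a [^] (p ^ j)" for a
  proof (rule frag_induction[OF subset_UNIV, where P = "\<lambda>a. g a = h a [^] (p ^ j)"])
    show "g (a - b) = h (a - b) [^] (p ^ j)"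
      if "g a = h a [^] (p ^ j)" "g b = h b [^] (p ^ j)" for a b
      using that h_simps(1) by (simp add: h_simps(4) g_simps(4) nat_pow_distrib nat_pow_inv)
  qed (use y(2) in \<open>simp_all add: h(2) g(2) h_simps(2) g_simps(2)\<close>)
  have g_p: "g a [^] p = \<one>" for a
    using hom_free_Abelian_group_mem[OF g(1) subgroup_roots, of a p] xc xp by (simp add: g(2))
  have dvd1: "int p dvd Poly_Mapping.lookup b i"
    if "Poly_Mapping.keys b \<subseteq> {..<n}" "g b \<in> socle p (Suc j)" for b n i
    using that
  proof (induction n arbitrary: b)
    case 0
    then have "b = 0" by auto
    then show ?case by simp
  next
    case (Suc n)
    define c where "c = Poly_Mapping.lookup b n"
    define b' where "b' = b - frag_cmul c (frag_of n)"
    have look: "Poly_Mapping.lookup b' i = (if i = n then 0 else Poly_Mapping.lookup b i)" for i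
      by (auto simp: b'_def c_def lookup_minus)
    have keys: "Poly_Mapping.keys b' \<subseteq> {..<n}"
    proof
      fix i assume "i \<in> Poly_Mapping.keys b'"
      then have "i \<noteq> n" "i \<in> Poly_Mapping.keys b"
        by (auto simp: in_keys_iff look split: if_splits)
      then show "i \<in> {..<n}" using Suc.prems(1) by auto
    qed
    have gb: "g b = x n [^] c \<otimes> g b'"
      using g_simps(3)[of "frag_cmul c (frag_of n)" b'] by (simp add: b'_def g_simps(5) g(2))
    have c_dvd: "int p dvd c"
    proof (rule ccontr)
      assume "\<not> int p dvd c"
      then have cop: "coprime c (int p)"
        using p by (metis coprime_commute prime_imp_coprime prime_nat_int_transfer)
      have "g b' \<in> U n"
        by (rule hom_free_Abelian_group_mem[OF g(1) U(1)]) (use keys x_U g(2) in auto)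
      moreover have "x n [^] c \<otimes> g b' \<in> U n"
        using Suc.prems(2) U(2) gb by auto
      ultimately have "x n [^] c \<in> U n"
        using subgroup_mult_cancel[OF U(1) int_pow_closed[OF xc]] by blast
      moreover have "x n [^] int p \<in> U n"
        unfolding int_pow_int xp by (rule subgroup.one_closed[OF U(1)])
      ultimately have "x n \<in> U n"
        using subgroup_coprime_pow[OF U(1) xc] cop by blast
      then show False using x(2) by blast
    qed
    then obtain d where d: "c = int p * d" by blast
    have "x n [^] c = (x n [^] int p) [^] d"
      unfolding d by (rule int_pow_pow[OF xc, symmetric])
    then have "x n [^] c = \<one>" by (simp add: int_pow_int xp)
    then have "g b' \<in> socle p (Suc j)"
      using gb Suc.prems(2) g_simps(1) by simp
    then have "int p dvd Poly_Mapping.lookup b' i"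
      by (rule Suc.IH[OF keys])
    then show ?case
      using c_dvd by (cases "i = n") (simp_all add: look c_def)
  qed
  have dvd2: "int (p ^ t) dvd Poly_Mapping.lookup a i"
    if "h a \<in> powers (p ^ Suc j)" "t \<le> Suc j" for a t i
    using that(2)
  proof (induction t arbitrary: i)
    case (Suc t)
    have "\<And>i. int (p ^ t) dvd Poly_Mapping.lookup a i"
      using Suc by simp
    then obtain b where b: "a = frag_cmul (int (p ^ t)) b"
      using frag_divisible by metis
    have "g b = h (frag_cmul (int (p ^ (j - t))) a)"
      using Suc.prems by (simp add: g_eq b h_simps(5) int_pow_int[symmetric] power_add[symmetric])
    also have "\<dots> = h a [^] int (p ^ (j - t))"
      by (rule h_simps(5))
    also have "\<dots> \<in> powers (p ^ Suc j)"
      by (rule subgroup_int_pow_closed[OF subgroup_powers that(1)])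
    finally have "g b \<in> socle p (Suc j)"
      using g_p by (simp add: socle_def)
    moreover obtain n where "Poly_Mapping.keys b \<subseteq> {..<n}"
      using finite_nat_iff_bounded finite_keys by blast
    ultimately have "int p dvd Poly_Mapping.lookup b i"
      using dvd1 by blast
    then show ?case
      by (simp add: b mult_dvd_mono mult.commute)
  qed simp
  have "\<not> strongly_Hopfian G"
  proof (rule not_SH_if_infinite_homocyclic[OF p h(1)])
    show "h (frag_of i) [^] (p ^ Suc j) = \<one>" for i
    proof -
      have "h (frag_of i) [^] (p ^ Suc j) = (y i [^] (p ^ j)) [^] p"
        unfolding h(2) nat_pow_pow[OF y(1)] power_Suc2 ..
      then show ?thesis using xp y(2) by simp
    qed
  qed (rule dvd2[OF _ order_refl])
  with SH show False by blast
qed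

lemma power_funpow: "x \<in> carrier G \<Longrightarrow> ((\<lambda>x. x [^] (n::nat)) ^^ k) x = x [^] (n ^ k)"
  by (induction k) (simp_all add: nat_pow_pow mult.commute)

text \<open>
  Strong Hopficity for the endomorphism \<open>x [^] p\<close> bounds both the \<open>p\<close>-torsion and the heights of
  the nontrivial elements annihilated by \<open>p\<close>; descending induction on the height then makes the
  whole \<open>p\<close>-torsion finite.
\<close>

lemma finite_p_torsion_if_SH:
  assumes p: "prime (p::nat)" and SH: "strongly_Hopfian G"
  shows "finite (p_torsion_set p G)"
proof -
  obtain k where "SH_exponent G (\<lambda>x. x [^] p) k"
    using SH power_hom unfolding strongly_Hopfian_def by blast
  then have k: "x [^] (p ^ k) = \<one>" if "x \<in> carrier G" "x [^] (p ^ Suc k) = \<one>" for x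
    using that unfolding SH_exponent_iff[OF power_hom] by (simp add: power_funpow del: funpow.simps power_Suc)
  have fin: "finite (socle p i)" if "i \<le> k" for i
    using that
  proof (induction i rule: inc_induct)
    case base
    have "socle p k \<subseteq> {\<one>}"
    proof
      fix x assume "x \<in> socle p k"
      then obtain y where y: "y \<in> carrier G" "x = y [^] (p ^ k)" "x [^] p = \<one>"
        by (auto simp: socle_def powers_def)
      then have "y [^] (p ^ Suc k) = \<one>" by (simp add: nat_pow_pow mult.commute)
      then show "x \<in> {\<one>}" using k y by simp
    qed
    then show ?case by (rule finite_subset) simp
  next
    case (step i)
    then show ?case using finite_socle_if_SH[OF p SH] by blast
  qed
  have fin0: "finite {x \<in> carrier G. x [^] p = \<one>}"
    using fin[of 0] by (rule finite_subset[rotated]) (auto simp: socle_def powers_def)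
  have fin_i: "finite {x \<in> carrier G. x [^] (p ^ i) = \<one>}" (is "finite (?R i)") for i
  proof (induction i)
    case 0
    have "?R 0 \<subseteq> {\<one>}" by auto
    then show ?case by (rule finite_subset) simp
  next
    case (Suc i)
    show ?case
    proof (rule ccontr)
      assume inf: "infinite (?R (Suc i))"
      have "(\<lambda>x. x [^] p) ` ?R (Suc i) \<subseteq> ?R i"
        by (auto simp: nat_pow_pow)
      then have "finite ((\<lambda>x. x [^] p) ` ?R (Suc i))"
        using Suc.IH by (rule finite_subset)
      from pigeonhole_infinite[OF inf this] obtain a where
        a: "a \<in> ?R (Suc i)" "infinite {x \<in> ?R (Suc i). x [^] p = a [^] p}" by blast
      have ac: "a \<in> carrier G" using a(1) by simp
      have "{x \<in> ?R (Suc i). x [^] p = a [^] p} \<subseteq> (\<lambda>s. a \<otimes> s) ` {x \<in> carrier G. x [^] p = \<one>}"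
      proof
        fix x assume x: "x \<in> {x \<in> ?R (Suc i). x [^] p = a [^] p}"
        then have "x = a \<otimes> (inv a \<otimes> x)" "(inv a \<otimes> x) [^] p = \<one>"
          using ac by (simp_all add: m_assoc[symmetric] nat_pow_distrib nat_pow_inv)
        then show "x \<in> (\<lambda>s. a \<otimes> s) ` {x \<in> carrier G. x [^] p = \<one>}"
          using x ac by (intro image_eqI[of _ _ "inv a \<otimes> x"]) simp_all
      qed
      then show False using a(2) fin0 finite_subset by blast
    qed
  qed
  have "x [^] (p ^ k) = \<one>" if "x \<in> carrier G" "x [^] (p ^ i) = \<one>" for x i
    using that
  proof (induction i arbitrary: x)
    case (Suc i)
    then have "(x [^] p) [^] (p ^ i) = \<one>" "x [^] p \<in> carrier G"
      by (simp_all add: nat_pow_pow)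
    then have "x [^] (p ^ Suc k) = \<one>"
      using Suc.IH[of "x [^] p"] Suc.prems(1) by (simp add: nat_pow_pow)
    then show ?case using k Suc.prems(1) by blast
  qed simp
  then have "p_torsion_set p G \<subseteq> ?R k"
    by (auto simp: p_torsion_set_def)
  then show ?thesis using fin_i by (rule finite_subset)
qed

section \<open>Strongly Hopfian torsion groups are uniformly strongly Hopfian\<close>

lemma subgroup_p_torsion_set: "subgroup (p_torsion_set p G) G"
proof (rule subgroupI)
  have "\<one> [^] (p ^ 0) = \<one>" by simp
  then show "p_torsion_set p G \<noteq> {}"
    unfolding p_torsion_set_def using one_closed by blast
  show "inv x \<in> p_torsion_set p G" if "x \<in> p_torsion_set p G" for x
    using that by (auto simp: p_torsion_set_def nat_pow_inv)
  show "x \<otimes> y \<in> p_torsion_set p G" if x: "x \<in> p_torsion_set p G" and y: "y \<in> p_torsion_set p G" for x y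
  proof -
    obtain k l :: nat where kl: "x [^] (p ^ k) = \<one>" "y [^] (p ^ l) = \<one>"
      using x y by (auto simp: p_torsion_set_def)
    have c: "x \<in> carrier G" "y \<in> carrier G"
      using x y by (auto simp: p_torsion_set_def)
    have "(x \<otimes> y) [^] (p ^ (k + l)) = (x [^] (p ^ k)) [^] (p ^ l) \<otimes> (y [^] (p ^ l)) [^] (p ^ k)"
      using c by (simp add: nat_pow_distrib nat_pow_pow power_add mult.commute)
    then have "(x \<otimes> y) [^] (p ^ (k + l)) = \<one>"
      using kl by simp
    then show ?thesis
      using c unfolding p_torsion_set_def by blast
  qed
qed (auto simp: p_torsion_set_def)

text \<open>The elements of order prime to \<open>p\<close>.\<close>

definition p'_torsion_set :: "nat \<Rightarrow> 'a set" where
  "p'_torsion_set p = {x \<in> carrier G. \<exists>n::nat. \<not> p dvd n \<and> x [^] n = \<one>}"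

lemma subgroup_p'_torsion_set:
  assumes "prime (p::nat)"
  shows "subgroup (p'_torsion_set p) G"
proof (rule subgroupI)
  have "\<not> p dvd 1" "\<one> [^] (1::nat) = \<one>" using assms by auto
  then show "p'_torsion_set p \<noteq> {}"
    unfolding p'_torsion_set_def using one_closed by blast
  show "inv x \<in> p'_torsion_set p" if "x \<in> p'_torsion_set p" for x
    using that by (auto simp: p'_torsion_set_def nat_pow_inv)
  show "x \<otimes> y \<in> p'_torsion_set p" if x: "x \<in> p'_torsion_set p" and y: "y \<in> p'_torsion_set p" for x y
  proof -
    obtain m n :: nat where mn: "\<not> p dvd m" "x [^] m = \<one>" "\<not> p dvd n" "y [^] n = \<one>"
      using x y by (auto simp: p'_torsion_set_def)
    have c: "x \<in> carrier G" "y \<in> carrier G"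
      using x y by (auto simp: p'_torsion_set_def)
    have "(x \<otimes> y) [^] (m * n) = (x [^] m) [^] n \<otimes> (y [^] n) [^] m"
      using c by (simp add: nat_pow_distrib nat_pow_pow mult.commute)
    then have "(x \<otimes> y) [^] (m * n) = \<one>"
      using mn by simp
    moreover have "\<not> p dvd m * n" using mn assms by (simp add: prime_dvd_mult_iff)
    ultimately show ?thesis
      using c unfolding p'_torsion_set_def by blast
  qed
qed (auto simp: p'_torsion_set_def)

lemma p_torsion_inter_p'_torsion:
  assumes "prime (p::nat)" "x \<in> p_torsion_set p G" "x \<in> p'_torsion_set p"
  shows "x = \<one>"
proof -
  obtain k n :: nat where kn: "x [^] (p ^ k) = \<one>" "\<not> p dvd n" "x [^] n = \<one>"
    and x: "x \<in> carrier G"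
    using assms(2,3) by (auto simp: p_torsion_set_def p'_torsion_set_def)
  have "coprime (int (p ^ k)) (int n)"
    using kn(2) assms(1) by (simp add: prime_imp_coprime)
  then have "x \<in> {\<one>}"
    using subgroup_coprime_pow[OF triv_subgroup x, of "int (p ^ k)" "int n"] kn
    unfolding int_pow_int by simp
  then show ?thesis by simp
qed

lemma torsion_eq_p_mult_p'_torsion:
  assumes p: "prime (p::nat)" and tors: "torsion_set G = carrier G"
  shows "p'_torsion_set p <#> p_torsion_set p G = carrier G"
proof
  show "p'_torsion_set p <#> p_torsion_set p G \<subseteq> carrier G"
    by (auto simp: set_mult_def p'_torsion_set_def p_torsion_set_def)
  show "carrier G \<subseteq> p'_torsion_set p <#> p_torsion_set p G"
  proof
    fix x assume x: "x \<in> carrier G"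
    then obtain m :: nat where m: "m > 0" "x [^] m = \<one>"
      using tors by (auto simp: torsion_set_def)
    obtain k r where r: "m = p ^ k * r" "\<not> p dvd r"
      using prime_power_canonical[OF p m(1)] by (metis mult.commute)
    define S where "S = p'_torsion_set p <#> p_torsion_set p G"
    have S: "subgroup S G" "p'_torsion_set p \<subseteq> S" "p_torsion_set p G \<subseteq> S"
      unfolding S_def
      by (rule mult_subgroups[OF subgroup_p'_torsion_set[OF p] subgroup_p_torsion_set]
          subset_set_mult[OF subgroup_p'_torsion_set[OF p] subgroup_p_torsion_set])+
    have "(x [^] (p ^ k)) [^] r = \<one>"
      using m(2) by (simp add: nat_pow_pow x r(1))
    then have "x [^] (p ^ k) \<in> S"
      using S(2) x r(2) by (auto simp: p'_torsion_set_def)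
    moreover have "(x [^] r) [^] (p ^ k) = \<one>"
      using m(2) by (simp add: nat_pow_pow x r(1) mult.commute)
    then have "x [^] r \<in> S"
      using S(3) x by (auto simp: p_torsion_set_def)
    moreover have "coprime (int (p ^ k)) (int r)"
      using r(2) p by (simp add: prime_imp_coprime)
    ultimately show "x \<in> p'_torsion_set p <#> p_torsion_set p G"
      using subgroup_coprime_pow[OF S(1) x, of "int (p ^ k)" "int r"]
      unfolding int_pow_int S_def by blast
  qed
qed

text \<open>
  The projections of a torsion group onto its primary components; the last two facts describe the
  kernel.
\<close>

lemma primary_projections:
  assumes tors: "torsion_set G = carrier G"
  obtains \<pi> where "\<And>p. prime (p::nat) \<Longrightarrow> \<pi> p \<in> hom G G"
    "\<And>p x. prime p \<Longrightarrow> x \<in> carrier G \<Longrightarrow> \<pi> p x \<in> p_torsion_set p G"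
    "\<And>p x. prime p \<Longrightarrow> x \<in> p_torsion_set p G \<Longrightarrow> \<pi> p x = x"
    "\<And>p x. prime p \<Longrightarrow> x \<in> p'_torsion_set p \<Longrightarrow> \<pi> p x = \<one>"
    "\<And>p x. prime p \<Longrightarrow> x \<in> carrier G \<Longrightarrow> \<pi> p x = \<one> \<Longrightarrow> x \<in> p'_torsion_set p"
proof -
  have "\<exists>\<pi>. \<pi> \<in> hom G G \<and> (\<forall>x\<in>carrier G. \<pi> x \<in> p_torsion_set p G) \<and>
      (\<forall>z\<in>p'_torsion_set p. \<forall>y\<in>p_torsion_set p G. \<pi> (z \<otimes> y) = y)" if p: "prime p" for p :: nat
  proof -
    have "p'_torsion_set p \<inter> p_torsion_set p G = {\<one>}"
      using p_torsion_inter_p'_torsion[OF p] subgroup.one_closed[OF subgroup_p_torsion_set]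
        subgroup.one_closed[OF subgroup_p'_torsion_set[OF p]] by blast
    from direct_projection[OF subgroup_p'_torsion_set[OF p] subgroup_p_torsion_set this
        torsion_eq_p_mult_p'_torsion[OF p tors]]
    show ?thesis by metis
  qed
  then obtain \<pi> where \<pi>: "\<And>p. prime (p::nat) \<Longrightarrow> \<pi> p \<in> hom G G"
    "\<And>p x. prime p \<Longrightarrow> x \<in> carrier G \<Longrightarrow> \<pi> p x \<in> p_torsion_set p G"
    "\<And>p z y. prime p \<Longrightarrow> z \<in> p'_torsion_set p \<Longrightarrow> y \<in> p_torsion_set p G \<Longrightarrow> \<pi> p (z \<otimes> y) = y"
    by metis
  show thesis
  proof (rule that[OF \<pi>(1,2)])
    fix p :: nat and x assume p: "prime p"
    note one = subgroup.one_closed[OF subgroup_p_torsion_set]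
      subgroup.one_closed[OF subgroup_p'_torsion_set[OF p]]
    show "\<pi> p x = x" if "x \<in> p_torsion_set p G"
      using \<pi>(3)[OF p one(2) that] subgroup.mem_carrier[OF subgroup_p_torsion_set that] by simp
    show "\<pi> p x = \<one>" if "x \<in> p'_torsion_set p"
      using \<pi>(3)[OF p that one(1)] subgroup.mem_carrier[OF subgroup_p'_torsion_set[OF p] that] by simp
    show "x \<in> p'_torsion_set p" if x: "x \<in> carrier G" "\<pi> p x = \<one>"
    proof -
      obtain z y where zy: "z \<in> p'_torsion_set p" "y \<in> p_torsion_set p G" "x = z \<otimes> y"
        using x(1) unfolding torsion_eq_p_mult_p'_torsion[OF p tors, symmetric] set_mult_def by blast
      then have "y = \<one>" using \<pi>(3)[OF p] x(2) by simp
      then show ?thesis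
        using zy subgroup.mem_carrier[OF subgroup_p'_torsion_set[OF p]] by simp
    qed
  qed
qed

lemma p_torsion_hom:
  assumes "\<phi> \<in> hom G G" "x \<in> p_torsion_set p G"
  shows "\<phi> x \<in> p_torsion_set p G"
proof -
  interpret h: group_hom G G \<phi>
    using assms by (simp add: group_hom_def group_hom_axioms_def)
  from assms(2) obtain k where k: "x \<in> carrier G" "x [^] (p ^ k) = \<one>"
    by (auto simp: p_torsion_set_def)
  have "\<phi> x [^] (p ^ k) = \<one>"
    using k by (metis h.hom_nat_pow h.hom_one)
  then show ?thesis using k(1) by (auto simp: p_torsion_set_def)
qed

lemma p'_torsion_hom:
  assumes "\<phi> \<in> hom G G" "x \<in> p'_torsion_set p"
  shows "\<phi> x \<in> p'_torsion_set p"
proof -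
  interpret h: group_hom G G \<phi>
    using assms by (simp add: group_hom_def group_hom_axioms_def)
  from assms(2) obtain n where n: "x \<in> carrier G" "\<not> p dvd n" "x [^] n = \<one>"
    by (auto simp: p'_torsion_set_def)
  have "\<phi> x [^] n = \<one>"
    using n by (metis h.hom_nat_pow h.hom_one)
  then show ?thesis using n(1,2) by (auto simp: p'_torsion_set_def)
qed

text \<open>
  The numbers \<open>n\<close> that fail to be an exponent for some endomorphism already on the
  \<open>p\<close>-component.
\<close>

definition bad_exponents :: "nat \<Rightarrow> nat set" where
  "bad_exponents p = {n. \<exists>\<phi>\<in>hom G G. \<exists>x\<in>p_torsion_set p G. (\<phi> ^^ n) x \<noteq> \<one> \<and> (\<phi> ^^ Suc n) x = \<one>}"

text \<open>
  If \<open>x\<close> is killed by \<open>\<phi> ^^ Suc n\<close> but not by \<open>\<phi> ^^ n\<close>, its first \<open>Suc n\<close> iterates are distinct.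
\<close>

lemma bad_exponents_less_card:
  assumes fin: "finite (p_torsion_set p G)" and n: "n \<in> bad_exponents p"
  shows "n < card (p_torsion_set p G)"
proof -
  obtain \<phi> x where \<phi>: "\<phi> \<in> hom G G" and x: "x \<in> p_torsion_set p G"
    and nx: "(\<phi> ^^ n) x \<noteq> \<one>" "(\<phi> ^^ Suc n) x = \<one>"
    using n unfolding bad_exponents_def by blast
  have one: "(\<phi> ^^ k) \<one> = \<one>" for k
    using hom_one[OF hom_funpow[OF \<phi>] group_axioms group_axioms] .
  have later: "(\<phi> ^^ k) x = \<one>" if "n < k" for k
  proof -
    have "(\<phi> ^^ k) x = (\<phi> ^^ (k - Suc n)) ((\<phi> ^^ Suc n) x)"
      using that by (metis Suc_leI comp_apply funpow_add le_add_diff_inverse2)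
    then show ?thesis using nx(2) one by simp
  qed
  have neq: "(\<phi> ^^ a) x \<noteq> (\<phi> ^^ b) x" if "a < b" "b \<le> n" for a b
  proof
    assume eq: "(\<phi> ^^ a) x = (\<phi> ^^ b) x"
    have "(\<phi> ^^ n) x = (\<phi> ^^ (n - a)) ((\<phi> ^^ a) x)"
      using that by (metis comp_apply funpow_add le_add_diff_inverse2 less_imp_le order.trans)
    also have "\<dots> = (\<phi> ^^ (n - a + b)) x"
      by (simp add: eq funpow_add)
    also have "\<dots> = \<one>"
      by (rule later) (use that in simp)
    finally show False using nx(1) by simp
  qed
  have "inj_on (\<lambda>k. (\<phi> ^^ k) x) {..n}"
    by (rule linorder_inj_onI) (use neq in auto)
  moreover have "(\<phi> ^^ k) x \<in> p_torsion_set p G" for k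
    by (rule p_torsion_hom[OF hom_funpow[OF \<phi>] x])
  ultimately have "card {..n} \<le> card (p_torsion_set p G)"
    using fin by (intro card_inj_on_le[where f = "\<lambda>k. (\<phi> ^^ k) x"]) auto
  then show ?thesis by simp
qed

text \<open>
  Since the primary components are fully invariant, endomorphisms chosen separately on each of
  them assemble to an endomorphism of the whole torsion group.
\<close>

lemma glue_primary_endomorphisms:
  assumes tors: "torsion_set G = carrier G" and \<psi>: "\<And>p. prime (p::nat) \<Longrightarrow> \<psi> p \<in> hom G G"
  shows "\<exists>\<phi>\<in>hom G G. \<forall>p. prime p \<longrightarrow> (\<forall>x\<in>p_torsion_set p G. \<phi> x = \<psi> p x)"
proof -
  obtain \<pi> where \<pi>: "\<And>p. prime (p::nat) \<Longrightarrow> \<pi> p \<in> hom G G"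
    "\<And>p x. prime p \<Longrightarrow> x \<in> carrier G \<Longrightarrow> \<pi> p x \<in> p_torsion_set p G"
    "\<And>p x. prime p \<Longrightarrow> x \<in> p_torsion_set p G \<Longrightarrow> \<pi> p x = x"
    "\<And>p x. prime p \<Longrightarrow> x \<in> p'_torsion_set p \<Longrightarrow> \<pi> p x = \<one>"
    by (rule primary_projections[OF tors]) blast
  define f where "f x p = \<psi> p (\<pi> p x)" for x p
  define \<phi> where "\<phi> x = gfinprod G (f x) {p. prime p}" for x
  have f_hom: "f (x \<otimes> y) p = f x p \<otimes> f y p" if "prime p" "x \<in> carrier G" "y \<in> carrier G" for x y p
    using that hom_mult[OF \<pi>(1)] hom_mult[OF \<psi>] hom_in_carrier[OF \<pi>(1)] by (simp add: f_def)
  have f_car: "f x \<in> {p. prime p} \<rightarrow> carrier G" if "x \<in> carrier G" for x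
    using that hom_in_carrier[OF \<psi> hom_in_carrier[OF \<pi>(1)]] by (auto simp: f_def)
  have f_one: "f x p = \<one>" if "prime p" "x \<in> p'_torsion_set p" for x p
    using that \<pi>(4) hom_one[OF \<psi> group_axioms group_axioms] by (simp add: f_def)
  have f_fin: "finite {p \<in> {p. prime p}. f x p \<noteq> \<one>}" if x: "x \<in> carrier G" for x
  proof -
    obtain m :: nat where m: "m > 0" "x [^] m = \<one>"
      using x tors by (auto simp: torsion_set_def)
    have "{p \<in> {p. prime p}. f x p \<noteq> \<one>} \<subseteq> {p. p dvd m}"
      using f_one m(2) x by (auto simp: p'_torsion_set_def)
    then show ?thesis
      by (rule finite_subset) (use m(1) in simp)
  qed
  show ?thesis
  proof (intro bexI[of _ \<phi>] allI impI ballI)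
    show "\<phi> \<in> hom G G"
    proof (rule homI)
      show "\<phi> x \<in> carrier G" if "x \<in> carrier G" for x
        unfolding \<phi>_def by (rule gfinprod_closed[OF f_car[OF that]])
      fix x y assume xy: "x \<in> carrier G" "y \<in> carrier G"
      have "\<phi> (x \<otimes> y) = gfinprod G (\<lambda>p. f x p \<otimes> f y p) {p. prime p}"
        unfolding \<phi>_def
        by (rule gfinprod_cong) (use xy f_hom f_car in \<open>auto simp: simp_implies_def Pi_iff\<close>)
      also have "\<dots> = \<phi> x \<otimes> \<phi> y"
        unfolding \<phi>_def by (rule gfinprod_distrib) (use xy f_fin f_car in auto)
      finally show "\<phi> (x \<otimes> y) = \<phi> x \<otimes> \<phi> y" .
    qed
    fix p x assume p: "prime (p::nat)" and x: "x \<in> p_torsion_set p G"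
    have xc: "x \<in> carrier G" using x by (simp add: p_torsion_set_def)
    have other: "f x l = \<one>" if "l \<in> {p. prime p} - {p}" for l
    proof -
      obtain k where "x [^] (p ^ k) = \<one>" using x by (auto simp: p_torsion_set_def)
      moreover have "\<not> l dvd p ^ k"
        using that p by (metis DiffE insertI1 mem_Collect_eq prime_dvd_power primes_dvd_imp_eq)
      ultimately have "x \<in> p'_torsion_set l"
        using xc by (auto simp: p'_torsion_set_def)
      then show ?thesis using f_one that by blast
    qed
    have "\<phi> x = gfinprod G (f x) {p}"
      unfolding \<phi>_def
      by (rule gfinprod_mono_neutral_cong_right[OF _ other refl f_car[OF xc]]) (use p in auto)
    also have "\<dots> = f x p"
      using f_car[OF xc] p by (simp add: Pi_iff)
    finally show "\<phi> x = \<psi> p x" using \<pi>(3)[OF p x] by (simp add: f_def)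
  qed
qed

text \<open>
  On each primary component choose an endomorphism of worst behaviour, which exists because the
  component is finite. An exponent for the endomorphism glued from these choices is an exponent
  for all endomorphisms.
\<close>

lemma uniformly_SH_if_SH_torsion:
  assumes tors: "torsion_set G = carrier G" and SH: "strongly_Hopfian G"
  shows "uniformly_strongly_Hopfian G"
proof (rule ccontr)
  assume not_uniform: "\<not> uniformly_strongly_Hopfian G"
  obtain \<pi> where \<pi>: "\<And>p. prime (p::nat) \<Longrightarrow> \<pi> p \<in> hom G G"
    "\<And>p x. prime p \<Longrightarrow> x \<in> carrier G \<Longrightarrow> \<pi> p x \<in> p_torsion_set p G"
    "\<And>p x. prime p \<Longrightarrow> x \<in> p_torsion_set p G \<Longrightarrow> \<pi> p x = x"
    "\<And>p x. prime p \<Longrightarrow> x \<in> p'_torsion_set p \<Longrightarrow> \<pi> p x = \<one>"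
    "\<And>p x. prime p \<Longrightarrow> x \<in> carrier G \<Longrightarrow> \<pi> p x = \<one> \<Longrightarrow> x \<in> p'_torsion_set p"
    by (rule primary_projections[OF tors]) blast
  have unbounded: "\<exists>p. prime p \<and> n \<in> bad_exponents p" if "n > 0" for n
  proof -
    obtain \<phi> where \<phi>: "\<phi> \<in> hom G G" "\<not> SH_exponent G \<phi> n"
      using not_uniform unfolding uniformly_strongly_Hopfian_def by blast
    then have "\<exists>x\<in>carrier G. (\<phi> ^^ Suc n) x = \<one> \<and> (\<phi> ^^ n) x \<noteq> \<one>"
      using \<open>n > 0\<close> by (simp add: SH_exponent_iff del: funpow.simps)
    then obtain x where x: "x \<in> carrier G" "(\<phi> ^^ Suc n) x = \<one>" "(\<phi> ^^ n) x \<noteq> \<one>"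
      by (elim bexE conjE)
    define y where "y = (\<phi> ^^ n) x"
    have yc: "y \<in> carrier G" unfolding y_def by (rule hom_in_carrier[OF hom_funpow[OF \<phi>(1)] x(1)])
    have "\<exists>p. prime p \<and> y \<notin> p'_torsion_set p"
    proof -
      define m where "m = (LEAST m::nat. m > 0 \<and> y [^] m = \<one>)"
      have "\<exists>m::nat. m > 0 \<and> y [^] m = \<one>"
        using yc tors by (auto simp: torsion_set_def)
      then have m: "m > 0" "y [^] m = \<one>"
        unfolding m_def by (metis (mono_tags, lifting) LeastI_ex)+
      have least: "\<not> (k > 0 \<and> y [^] k = \<one>)" if "k < m" for k :: nat
        using that unfolding m_def by (rule not_less_Least)
      have "m \<noteq> 1" using m(2) x(3) yc by (auto simp: y_def)
      then obtain p where p: "prime p" "p dvd m" using prime_factor_nat by blast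
      then obtain r where r: "m = p * r" by blast
      have "y \<notin> p'_torsion_set p"
      proof
        assume "y \<in> p'_torsion_set p"
        then have "y [^] r \<in> p'_torsion_set p"
          by (rule p'_torsion_hom[OF power_hom])
        moreover have "(y [^] r) [^] (p ^ 1) = \<one>"
          using m(2) yc by (simp add: nat_pow_pow r mult.commute)
        then have "y [^] r \<in> p_torsion_set p G"
          using yc unfolding p_torsion_set_def by blast
        ultimately have "y [^] r = \<one>"
          using p_torsion_inter_p'_torsion[OF p(1)] by blast
        moreover have "0 < r" "r < m"
          using r m(1) prime_gt_1_nat[OF p(1)] by auto
        ultimately show False using least by blast
      qed
      then show ?thesis using p(1) by blast
    qed
    then obtain p where p: "prime p" "y \<notin> p'_torsion_set p" by blast
    \<comment> \<open>The projection to the \<open>p\<close>-component commutes with endomorphisms, so the failure of \<open>n\<close> at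
      \<open>x\<close> persists at the \<open>p\<close>-component \<open>z\<close> of \<open>x\<close>.\<close>
    define z where "z = \<pi> p x"
    have zP: "z \<in> p_torsion_set p G" unfolding z_def by (rule \<pi>(2)[OF p(1) x(1)])
    have comm: "\<pi> p (h x) = h (\<pi> p x)" if h: "h \<in> hom G G" for h
    proof -
      have px: "\<pi> p x \<in> p_torsion_set p G" by (rule \<pi>(2)[OF p(1) x(1)])
      have pxc: "\<pi> p x \<in> carrier G" using px by (simp add: p_torsion_set_def)
      have "\<pi> p (x \<otimes> inv (\<pi> p x)) = \<one>"
      proof -
        interpret h: group_hom G G "\<pi> p"
          using \<pi>(1)[OF p(1)] by (simp add: group_hom_def group_hom_axioms_def)
        show ?thesis using x(1) pxc \<pi>(3)[OF p(1) px] by simp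
      qed
      then have "x \<otimes> inv (\<pi> p x) \<in> p'_torsion_set p"
        using \<pi>(5)[OF p(1)] x(1) pxc by simp
      then have hr: "h (x \<otimes> inv (\<pi> p x)) \<in> p'_torsion_set p"
        by (rule p'_torsion_hom[OF h])
      have "h x = h (x \<otimes> inv (\<pi> p x)) \<otimes> h (\<pi> p x)"
        using x(1) pxc hom_mult[OF h, symmetric] by (simp add: m_assoc)
      then have "\<pi> p (h x) = \<pi> p (h (x \<otimes> inv (\<pi> p x))) \<otimes> \<pi> p (h (\<pi> p x))"
        using hom_mult[OF \<pi>(1)[OF p(1)]] hom_in_carrier[OF h] x(1) pxc by simp
      also have "\<dots> = h (\<pi> p x)"
        using \<pi>(4)[OF p(1) hr] \<pi>(3)[OF p(1) p_torsion_hom[OF h px]] hom_in_carrier[OF h pxc] by simp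
      finally show ?thesis .
    qed
    have "(\<phi> ^^ n) z \<noteq> \<one>"
      using comm[OF hom_funpow[OF \<phi>(1)], of n] \<pi>(5)[OF p(1) yc] p(2) by (auto simp: y_def z_def)
    moreover have "(\<phi> ^^ Suc n) z = \<one>"
      using comm[OF hom_funpow[OF \<phi>(1)], of "Suc n"] x(2)
        hom_one[OF \<pi>(1)[OF p(1)] group_axioms group_axioms] by (simp add: z_def del: funpow.simps)
    ultimately show ?thesis
      using p(1) zP \<phi>(1) unfolding bad_exponents_def by blast
  qed
  define N where "N p = Max (bad_exponents p)" for p
  have bad_fin: "finite (bad_exponents p)" if "prime p" for p
    using bad_exponents_less_card[OF finite_p_torsion_if_SH[OF that SH]]
    by (meson finite_lessThan finite_subset lessThan_iff subsetI)
  have "\<exists>\<psi>. \<psi> \<in> hom G G \<and> (bad_exponents p \<noteq> {} \<longrightarrow>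
      (\<exists>x\<in>p_torsion_set p G. (\<psi> ^^ N p) x \<noteq> \<one> \<and> (\<psi> ^^ Suc (N p)) x = \<one>))" if "prime p" for p
  proof (cases "bad_exponents p = {}")
    case True
    then show ?thesis by (intro exI[of _ "\<lambda>x. x [^] (1::nat)"] conjI power_hom) simp
  next
    case False
    then have "N p \<in> bad_exponents p"
      using bad_fin[OF that] by (simp add: N_def)
    then have "\<exists>\<psi>\<in>hom G G. \<exists>x\<in>p_torsion_set p G. (\<psi> ^^ N p) x \<noteq> \<one> \<and> (\<psi> ^^ Suc (N p)) x = \<one>"
      unfolding bad_exponents_def by (rule CollectD)
    then obtain \<psi> where "\<psi> \<in> hom G G"
      "\<exists>x\<in>p_torsion_set p G. (\<psi> ^^ N p) x \<noteq> \<one> \<and> (\<psi> ^^ Suc (N p)) x = \<one>"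
      by (rule bexE)
    then show ?thesis by (intro exI[of _ \<psi>] conjI impI)
  qed
  then have "\<forall>p. \<exists>\<psi>. prime p \<longrightarrow> \<psi> \<in> hom G G \<and> (bad_exponents p \<noteq> {} \<longrightarrow>
      (\<exists>x\<in>p_torsion_set p G. (\<psi> ^^ N p) x \<noteq> \<one> \<and> (\<psi> ^^ Suc (N p)) x = \<one>))"
    by (simp only: ex_simps) (intro allI impI)
  from choice[OF this] obtain \<psi> where "\<forall>p. prime p \<longrightarrow> \<psi> p \<in> hom G G \<and> (bad_exponents p \<noteq> {} \<longrightarrow>
      (\<exists>x\<in>p_torsion_set p G. (\<psi> p ^^ N p) x \<noteq> \<one> \<and> (\<psi> p ^^ Suc (N p)) x = \<one>))"
    by (rule exE)
  then have \<psi>: "\<And>p. prime p \<Longrightarrow> \<psi> p \<in> hom G G"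
    "\<And>p. prime p \<Longrightarrow> bad_exponents p \<noteq> {} \<Longrightarrow>
      \<exists>x\<in>p_torsion_set p G. (\<psi> p ^^ N p) x \<noteq> \<one> \<and> (\<psi> p ^^ Suc (N p)) x = \<one>"
    by simp_all
  obtain \<phi> where \<phi>: "\<phi> \<in> hom G G"
    "\<And>p x. prime p \<Longrightarrow> x \<in> p_torsion_set p G \<Longrightarrow> \<phi> x = \<psi> p x"
    using glue_primary_endomorphisms[of \<psi>, OF tors \<psi>(1)] by blast
  obtain m where m: "SH_exponent G \<phi> m"
    using SH \<phi>(1) unfolding strongly_Hopfian_def by blast
  then have "m > 0" by (simp add: SH_exponent_def)
  then obtain p where p: "prime p" "m \<in> bad_exponents p"
    using unbounded by blast
  then obtain x where x: "x \<in> p_torsion_set p G"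
    "(\<psi> p ^^ N p) x \<noteq> \<one>" "(\<psi> p ^^ Suc (N p)) x = \<one>"
    using \<psi>(2) by blast
  have "m \<le> N p"
    unfolding N_def using bad_fin[OF p(1)] p(2) by simp
  have eq: "(\<phi> ^^ k) x = (\<psi> p ^^ k) x" for k
  proof (induction k)
    case (Suc k)
    then show ?case
      using \<phi>(2)[OF p(1) p_torsion_hom[OF hom_funpow[OF \<psi>(1)[OF p(1)]] x(1)]] by simp
  qed simp
  define x' where "x' = (\<phi> ^^ (N p - m)) x"
  have "x' \<in> carrier G"
    unfolding x'_def using x(1) by (intro hom_in_carrier[OF hom_funpow[OF \<phi>(1)]]) (simp add: p_torsion_set_def)
  moreover have "(\<phi> ^^ m) x' = (\<psi> p ^^ N p) x" "(\<phi> ^^ Suc m) x' = (\<psi> p ^^ Suc (N p)) x"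
    using \<open>m \<le> N p\<close> unfolding x'_def eq[symmetric]
    by (metis comp_apply funpow_add le_add_diff_inverse, metis comp_apply funpow_add le_add_diff_inverse add_Suc)
  ultimately show False
    using m x(2,3) unfolding SH_exponent_iff[OF \<phi>(1)] by metis
qed

end

section \<open>Invariance under isomorphism\<close>

lemma SH_exponent_iso:
  assumes "group G" "group H" "f \<in> iso G H" "\<phi> \<in> hom H H"
  shows "\<exists>\<psi>\<in>hom G G. \<forall>n. SH_exponent G \<psi> n \<longrightarrow> SH_exponent H \<phi> n"
proof -
  define g where "g = inv_into (carrier G) f"
  have f: "f \<in> hom G H" "bij_betw f (carrier G) (carrier H)"
    using assms(3) by (simp_all add: iso_def)
  have g: "g \<in> hom H G"
    using group.iso_set_sym[OF assms(1,3)] by (simp add: g_def iso_def)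
  have gf: "g (f x) = x" if "x \<in> carrier G" for x
    using f(2) that by (simp add: g_def bij_betw_inv_into_left)
  have fg: "f (g y) = y" if "y \<in> carrier H" for y
    using f(2) that by (simp add: g_def bij_betw_inv_into_right)
  have fc: "f x \<in> carrier H" if "x \<in> carrier G" for x
    using f(1) that by (rule hom_in_carrier)
  have gc: "g y \<in> carrier G" if "y \<in> carrier H" for y
    using g that by (rule hom_in_carrier)
  have \<phi>c: "(\<phi> ^^ n) y \<in> carrier H" if "y \<in> carrier H" for n y
    using that hom_in_carrier[OF assms(4)] by (induction n) auto
  define \<psi> where "\<psi> = g \<circ> (\<phi> \<circ> f)"
  have \<psi>: "\<psi> \<in> hom G G"
    unfolding \<psi>_def by (intro hom_compose[OF hom_compose[OF f(1) assms(4)] g])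
  have pow: "(\<psi> ^^ n) (g y) = g ((\<phi> ^^ n) y)" if "y \<in> carrier H" for n y
    by (induction n) (simp_all add: \<psi>_def fg \<phi>c that)
  have "SH_exponent H \<phi> n" if n: "SH_exponent G \<psi> n" for n
    unfolding SH_exponent_def
  proof (intro conjI inj_onI)
    show "n > 0" using n by (simp add: SH_exponent_def)
    fix u v assume uv: "u \<in> (\<phi> ^^ n) ` carrier H" "v \<in> (\<phi> ^^ n) ` carrier H" "\<phi> u = \<phi> v"
    then obtain y z where yz: "y \<in> carrier H" "u = (\<phi> ^^ n) y" "z \<in> carrier H" "v = (\<phi> ^^ n) z"
      by blast
    have car: "u \<in> carrier H" "v \<in> carrier H" using yz \<phi>c by auto
    have "g u \<in> (\<psi> ^^ n) ` carrier G" "g v \<in> (\<psi> ^^ n) ` carrier G"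
      using pow[OF yz(1), of n] pow[OF yz(3), of n] yz gc by (metis imageI)+
    moreover have "\<psi> (g u) = \<psi> (g v)"
      using uv(3) car by (simp add: \<psi>_def fg)
    ultimately have "g u = g v"
      using n unfolding SH_exponent_def by (metis inj_onD)
    then show "u = v" using fg car by metis
  qed
  then show ?thesis using \<psi> by blast
qed

lemma strongly_Hopfian_iso:
  assumes "group G" "group H" "G \<cong> H" "strongly_Hopfian G"
  shows "strongly_Hopfian H"
proof -
  obtain f where "f \<in> iso G H" using assms(3) by (auto simp: is_iso_def)
  from SH_exponent_iso[OF assms(1,2) this] assms(4) show ?thesis
    unfolding strongly_Hopfian_def by meson
qed

lemma uniformly_strongly_Hopfian_iso:
  assumes "group G" "group H" "G \<cong> H" "uniformly_strongly_Hopfian G"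
  shows "uniformly_strongly_Hopfian H"
proof -
  obtain f where "f \<in> iso G H" using assms(3) by (auto simp: is_iso_def)
  from SH_exponent_iso[OF assms(1,2) this] assms(4) show ?thesis
    unfolding uniformly_strongly_Hopfian_def by meson
qed

lemma torsion_subgroup_iso:
  assumes "comm_group G" "comm_group H" "G \<cong> H"
  shows "torsion_subgroup G \<cong> torsion_subgroup H"
proof -
  obtain f where f: "f \<in> iso G H" using assms(3) by (auto simp: is_iso_def)
  have hom: "f \<in> hom G H" and bij: "bij_betw f (carrier G) (carrier H)"
    using f by (simp_all add: iso_def)
  have inv: "inv_into (carrier G) f \<in> hom H G"
    using group.iso_set_sym[OF comm_group.axioms(2)[OF assms(1)] f] by (simp add: iso_def)
  have sub: "torsion_set G \<subseteq> carrier G" by (auto simp: torsion_set_def)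
  have "f ` torsion_set G = torsion_set H"
  proof
    show "f ` torsion_set G \<subseteq> torsion_set H"
      using torsion_set_hom[OF assms(1,2) hom] by blast
    show "torsion_set H \<subseteq> f ` torsion_set G"
    proof
      fix y assume y: "y \<in> torsion_set H"
      then have "inv_into (carrier G) f y \<in> torsion_set G"
        by (rule torsion_set_hom[OF assms(2,1) inv])
      moreover have "f (inv_into (carrier G) f y) = y"
        using bij y by (simp add: bij_betw_inv_into_right torsion_set_def)
      ultimately show "y \<in> f ` torsion_set G" by (metis imageI)
    qed
  qed
  then have "bij_betw f (torsion_set G) (torsion_set H)"
    using bij sub by (metis bij_betw_subset)
  moreover have "f \<in> hom (torsion_subgroup G) (torsion_subgroup H)"
  proof (rule homI)
    show "f x \<in> carrier (torsion_subgroup H)" if "x \<in> carrier (torsion_subgroup G)" for x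
      using torsion_set_hom[OF assms(1,2) hom] that by simp
    show "f (x \<otimes>\<^bsub>torsion_subgroup G\<^esub> y) = f x \<otimes>\<^bsub>torsion_subgroup H\<^esub> f y"
      if "x \<in> carrier (torsion_subgroup G)" "y \<in> carrier (torsion_subgroup G)" for x y
      using that sub hom_mult[OF hom] by auto
  qed
  ultimately have "f \<in> iso (torsion_subgroup G) (torsion_subgroup H)"
    by (simp add: iso_def)
  then show ?thesis by (auto simp: is_iso_def)
qed

theorem corollary3p4:
  fixes G :: "'g monoid" and A :: "'i \<Rightarrow> 'a monoid" and I :: "'i set"
  assumes "warfield_group TYPE('x) G"
    and "G \<cong> sum_group I A"
    and "\<And>i. i \<in> I \<Longrightarrow> class_B (A i)"
    and "strongly_Hopfian (torsion_subgroup G)"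
  shows "(uniformly_strongly_Hopfian G \<longleftrightarrow> strongly_Hopfian G) \<and>
    (strongly_Hopfian G \<longleftrightarrow>
      (\<exists>n>0. \<not> (\<exists>js. distinct js \<and> set js \<subseteq> I \<and> length js = n \<and>
         (\<forall>k. Suc k < n \<longrightarrow> A (js ! k) \<precsim> A (js ! Suc k)))))"
proof -
  interpret G: comm_group G
    using assms(1) by (simp add: warfield_group_def)
  interpret rank_one_sum I A
    by (rule rank_one_sum.intro) (use assms(3) in \<open>simp_all add: class_B_def\<close>)
  interpret T: comm_group "torsion_subgroup D"
    by (rule D.comm_group_torsion_subgroup)
  have iso: "G \<cong> D" "D \<cong> G"
    using assms(2) G.iso_sym by blast+
  have "strongly_Hopfian (torsion_subgroup D)"
    using comm_group.axioms(2)[OF G.comm_group_torsion_subgroup] T.group_axioms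
      torsion_subgroup_iso[OF G.comm_group_axioms D.comm_group_axioms iso(1)] assms(4)
    by (rule strongly_Hopfian_iso)
  moreover have "torsion_set (torsion_subgroup D) = carrier (torsion_subgroup D)"
    by (auto simp: torsion_set_def nat_pow_def)
  ultimately have T: "uniformly_strongly_Hopfian (torsion_subgroup D)"
    by (intro T.uniformly_SH_if_SH_torsion)
  have 1: "strongly_Hopfian G" if "uniformly_strongly_Hopfian G"
    using that unfolding uniformly_strongly_Hopfian_def strongly_Hopfian_def by blast
  have 2: "\<exists>n>0. \<not> has_chain n" if "strongly_Hopfian G"
  proof (rule ccontr)
    assume "\<not> (\<exists>n>0. \<not> has_chain n)"
    moreover have "has_chain 0"
      by (simp add: has_chain_def)
    ultimately have "has_chain n" for n
      by (cases "n = 0") blast+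
    then have "\<not> strongly_Hopfian D"
      by (rule not_SH_if_unbounded_chains)
    then show False
      using strongly_Hopfian_iso[OF G.group_axioms D.group_axioms iso(1) that] by blast
  qed
  have 3: "uniformly_strongly_Hopfian G" if "\<exists>n>0. \<not> has_chain n"
  proof -
    have "uniformly_strongly_Hopfian D"
      using uniformly_SH_if_bounded_chains T that by blast
    then show ?thesis
      by (rule uniformly_strongly_Hopfian_iso[OF D.group_axioms G.group_axioms iso(2)])
  qed
  from 1 2 3 show ?thesis
    unfolding has_chain_def by blast
qed

end
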